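(* Fix $0<a\le b$. There are constants $A>0$ and $N_0\in\mathbb N$ depending only on $a,b$ such that for every $N\ge N_0$, every $\mu\in\mathcal M_{a,b,N^{-1}}(\mathbb T^N)$ that is a probability measure, every $g\in\mathcal O_{N^{-1}}(\mathbb T^N)$ and every $\epsilon>0$, $$\mu\big(|g-\mathbb E_\mu[g]|\ge\epsilon\big)\le2\exp\Big[-\frac{\epsilon^2N}{(1+A N^{-1})^2}\Big].$$
   Context: $\mathbb T=\mathbb R/\mathbb Z$ with torus distance. $\mathcal V_a:=\{\psi\in C^2(\mathbb T,(0,\infty)):|\frac d{dx}\log\psi(x)|<a\ \forall x\}$; for $\psi_1,\psi_2\in\mathcal V_a$, $\beta_a(\psi_1,\psi_2):=\inf\{t>0:t\psi_1-\psi_2\in\mathcal V_a\}$, $\theta_a:=\log\beta_a(\psi_1,\psi_2)+\log\beta_a(\psi_2,\psi_1)$. For $\boldsymbol x\in\mathbb T^N$, $\hat{\boldsymbol x}_i$ is $\boldsymbol x$ without its $i$-th coordinate and $\boldsymbol x=(x_i;\hat{\boldsymbol x}_i)$. For a measure $\mu$ on $\mathbb T^N$ with density $\rho\in C^2(\mathbb T^N,(0,\infty))$, $\rho_{\hat{\boldsymbol x}_i}(x):=\rho(x;\hat{\boldsymbol x}_i)/\int\rho(s;\hat{\boldsymbol x}_i)ds$. $\mu\in\mathcal M_{a,b,L}$ iff for every $i$: $\rho_{\hat{\boldsymbol x}_i}\in\mathcal V_a$ for all $\hat{\boldsymbol x}_i$, and $\theta_b(\rho_{\hat{\boldsymbol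 x}_i},\rho_{\hat{\boldsymbol x}'_i})\le L|x_j-x'_j|$ whenever $\hat{\boldsymbol x}_i,\hat{\boldsymbol x}'_i$ differ only in some coordinate $j\neq i$ (values $x_j,x_j'$). Oscillation: for $\psi:\mathbb T^k\to\mathbb R$, $\mathrm{Osc}_j\psi:=\sup\{|\psi(x_j;\hat{\boldsymbol x}_j)-\psi(x_j';\hat{\boldsymbol x}_j)|:x_j,x_j'\in\mathbb T,\hat{\boldsymbol x}_j\in\mathbb T^{k-1}\}$, and $\mathcal O_\alpha(\mathbb T^k):=\{\psi\in L^1(\mathbb T^k):\mathrm{Osc}_j\psi\le\alpha\ \forall j\in[1,k]\}$. *)

theory Defs
  imports "HOL-Analysis.Analysis" "HOL-Probability.Probability"
begin

text \<open>The torus T = R/Z is modelled by 1-periodic functions on the reals;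
points of T^N by functions nat => real (only coordinates i < N matter).\<close>

definition tdist :: "real \<Rightarrow> real \<Rightarrow> real" where
  "tdist u v = \<bar>(u - v) - of_int (round (u - v))\<bar>"

definition C2_real :: "(real \<Rightarrow> real) \<Rightarrow> bool" where
  "C2_real f \<longleftrightarrow> (\<forall>x. f differentiable (at x)) \<and> (\<forall>x. deriv f differentiable (at x))
     \<and> continuous_on UNIV (deriv (deriv f))"

definition Vcone :: "real \<Rightarrow> (real \<Rightarrow> real) \<Rightarrow> bool" where
  "Vcone a \<psi> \<longleftrightarrow> C2_real \<psi> \<and> (\<forall>x. \<psi> x > 0) \<and> (\<forall>x. \<psi> (x + 1) = \<psi> x)
     \<and> (\<forall>x. \<bar>deriv (\<lambda>t. ln (\<psi> t)) x\<bar> < a)"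

definition beta_cone :: "real \<Rightarrow> (real \<Rightarrow> real) \<Rightarrow> (real \<Rightarrow> real) \<Rightarrow> real" where
  "beta_cone a \<psi>1 \<psi>2 = Inf {t. t > 0 \<and> Vcone a (\<lambda>x. t * \<psi>1 x - \<psi>2 x)}"

definition theta_cone :: "real \<Rightarrow> (real \<Rightarrow> real) \<Rightarrow> (real \<Rightarrow> real) \<Rightarrow> real" where
  "theta_cone a \<psi>1 \<psi>2 = ln (beta_cone a \<psi>1 \<psi>2) + ln (beta_cone a \<psi>2 \<psi>1)"

definition pderiv_coord :: "nat \<Rightarrow> ((nat \<Rightarrow> real) \<Rightarrow> real) \<Rightarrow> (nat \<Rightarrow> real) \<Rightarrow> real" where
  "pderiv_coord i f x = deriv (\<lambda>t. f (x(i := t))) (x i)"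

definition C2_multi :: "nat \<Rightarrow> ((nat \<Rightarrow> real) \<Rightarrow> real) \<Rightarrow> bool" where
  "C2_multi N f \<longleftrightarrow> continuous_on UNIV f
     \<and> (\<forall>i<N. \<forall>x. (\<lambda>t. f (x(i := t))) differentiable (at (x i)))
     \<and> (\<forall>i<N. continuous_on UNIV (pderiv_coord i f))
     \<and> (\<forall>i<N. \<forall>j<N. \<forall>x. (\<lambda>t. pderiv_coord i f (x(j := t))) differentiable (at (x j)))
     \<and> (\<forall>i<N. \<forall>j<N. continuous_on UNIV (pderiv_coord j (pderiv_coord i f)))"

definition torus_density :: "nat \<Rightarrow> ((nat \<Rightarrow> real) \<Rightarrow> real) \<Rightarrow> bool" where
  "torus_density N \<rho> \<longleftrightarrow> (\<forall>x y. (\<forall>i<N. x i = y i) \<longrightarrow> \<rho> x = \<rho> y)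
     \<and> (\<forall>x. \<forall>i<N. \<rho> (x(i := x i + 1)) = \<rho> x)
     \<and> (\<forall>x. \<rho> x > 0) \<and> C2_multi N \<rho>"

definition torus_leb :: "nat \<Rightarrow> (nat \<Rightarrow> real) measure" where
  "torus_leb N = PiM {..<N} (\<lambda>_. restrict_space lborel {0..<1})"

text \<open>Conditional density rho_{hat x_i}: the i-th coordinate of x is ignored.\<close>
definition cond_density :: "((nat \<Rightarrow> real) \<Rightarrow> real) \<Rightarrow> nat \<Rightarrow> (nat \<Rightarrow> real) \<Rightarrow> real \<Rightarrow> real" where
  "cond_density \<rho> i x s = \<rho> (x(i := s)) / integral {0..1} (\<lambda>t. \<rho> (x(i := t)))"

definition class_M :: "real \<Rightarrow> real \<Rightarrow> real \<Rightarrow> nat \<Rightarrow> ((nat \<Rightarrow> real) \<Rightarrow> real) \<Rightarrow> bool" where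
  "class_M a b L N \<rho> \<longleftrightarrow> torus_density N \<rho> \<and>
     (\<forall>i<N. (\<forall>x. Vcone a (cond_density \<rho> i x)) \<and>
        (\<forall>j<N. j \<noteq> i \<longrightarrow> (\<forall>x y.
           theta_cone b (cond_density \<rho> i x) (cond_density \<rho> i (x(j := y))) \<le> L * tdist (x j) y)))"

definition osc_class :: "real \<Rightarrow> nat \<Rightarrow> ((nat \<Rightarrow> real) \<Rightarrow> real) \<Rightarrow> bool" where
  "osc_class \<alpha> N g \<longleftrightarrow> integrable (torus_leb N) g \<and>
     (\<forall>j<N. \<forall>x\<in>space (torus_leb N). \<forall>y\<in>{0..<1}. \<bar>g (x(j := y)) - g x\<bar> \<le> \<alpha>)"

end

theory Submission
  imports Defs "HOL-Library.Periodic_Fun"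
begin

text \<open>
  Since a difference \<open>t \<psi>\<^sub>1 - \<psi>\<^sub>2\<close> in the cone is positive, \<open>\<theta>\<^sub>b\<close> dominates the projective distance
  of the cone of positive functions. As torus distances are at most 1/2, membership in the class
  with \<open>L = 1/N\<close> bounds every cross ratio
  \<open>\<rho>(x\<^sub>i, x\<^sub>j) \<rho>(x'\<^sub>i, x'\<^sub>j) / (\<rho>(x'\<^sub>i, x\<^sub>j) \<rho>(x\<^sub>i, x'\<^sub>j))\<close> by \<open>K = exp (1 / (2N))\<close>. Such a bound makes
  the conditional means of a function of oscillation \<open>\<delta>\<close> vary by at most \<open>\<delta> (K - 1) / 4\<close>, and
  integrating out one coordinate worsens \<open>K\<close> only to \<open>K (1 + (K - 1)\<^sup>2 / 4)\<close>. Hence \<open>K - 1 \<le> 1/N\<close>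
  persists while all \<open>N\<close> coordinates are integrated out, and the oscillations of the conditional
  expectations of \<open>g\<close> stay below \<open>(1 + 1/(4N))^N / N \<le> exp (1/4) / N\<close>. Hoeffding's lemma, applied
  coordinate by coordinate, yields the sub-Gaussian bound \<open>2 exp (- 2 \<epsilon>\<^sup>2 N / exp (1/2))\<close>, and
  \<open>exp (1/2) \<le> 2\<close>: the factor 2 in Hoeffding's exponent absorbs the dependence, for any \<open>A > 0\<close>.
\<close>

section \<open>Weighted means under a cross-ratio bound\<close>

text \<open>Oscillation hypotheses bound pairwise differences, whereas the estimates on means and
  Hoeffding's lemma ask for an enclosing interval. The infimum of the values serves as its left
  end.\<close>

lemma interval_of_pairwise_diff_le:
  fixes f :: "'a \<Rightarrow> real"
  assumes "\<And>s t. s \<in> S \<Longrightarrow> t \<in> S \<Longrightarrow> f s - f t \<le> \<delta>"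
  obtains c where "\<And>s. s \<in> S \<Longrightarrow> c \<le> f s \<and> f s \<le> c + \<delta>"
proof (cases "S = {}")
  case True
  then show ?thesis using that by blast
next
  case False
  then obtain t where t: "t \<in> S" by blast
  have bdd: "bdd_below (f ` S)"
    using assms[OF t] by (intro bdd_belowI2[of _ "f t - \<delta>"]) (simp add: algebra_simps)
  show ?thesis
  proof (rule that[of "Inf (f ` S)"])
    fix s assume s: "s \<in> S"
    have "f s - \<delta> \<le> Inf (f ` S)"
      using False assms[OF s] by (intro cINF_greatest) (auto simp: algebra_simps)
    then show "Inf (f ` S) \<le> f s \<and> f s \<le> Inf (f ` S) + \<delta>"
      using cINF_lower[OF bdd s] by simp
  qed
qed

context prob_space
begin

lemma integrable_bounded_real:
  fixes f :: "'a \<Rightarrow> real"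
  assumes "f \<in> borel_measurable M" "\<And>s. s \<in> space M \<Longrightarrow> \<bar>f s\<bar> \<le> B"
  shows "integrable M f"
  using assms by (intro integrable_const_bound[of _ B]) auto

lemma integral_bounds:
  fixes f :: "'a \<Rightarrow> real"
  assumes "f \<in> borel_measurable M" "\<And>s. s \<in> space M \<Longrightarrow> c \<le> f s \<and> f s \<le> C"
  shows "c \<le> expectation f \<and> expectation f \<le> C"
proof -
  have "integrable M f"
    using assms(2) by (intro integrable_bounded_real[OF assms(1), of "max \<bar>c\<bar> \<bar>C\<bar>"]) force
  then show ?thesis
    using assms(2) by (auto intro!: integral_ge_const integral_le_const)
qed

text \<open>If \<open>S = {p \<ge> q}\<close> and \<open>P\<close>, \<open>Q\<close> are the masses of \<open>S\<close>, integrating the cross-ratio bound over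
  \<open>S \<times> S\<^sup>c\<close> gives \<open>P (1 - Q) \<le> K (1 - P) Q\<close>, so that
  \<open>P - Q \<le> (K - 1) (1 - P) Q \<le> (K - 1) P (1 - P) \<le> (K - 1) / 4\<close>.\<close>

lemma expectation_diff_le_of_cross_ratio:
  fixes p q f :: "'a \<Rightarrow> real"
  assumes p: "integrable M p" "\<And>s. s \<in> space M \<Longrightarrow> 0 \<le> p s" "(\<integral>s. p s \<partial>M) = 1"
    and q: "integrable M q" "\<And>s. s \<in> space M \<Longrightarrow> 0 \<le> q s" "(\<integral>s. q s \<partial>M) = 1"
    and K: "1 \<le> K"
    and cross: "\<And>s t. s \<in> space M \<Longrightarrow> t \<in> space M \<Longrightarrow> p s * q t \<le> K * (p t * q s)"
    and f: "f \<in> borel_measurable M" "\<And>s. s \<in> space M \<Longrightarrow> c \<le> f s \<and> f s \<le> c + \<delta>"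
  shows "(\<integral>s. f s * p s \<partial>M) - (\<integral>s. f s * q s \<partial>M) \<le> \<delta> * ((K - 1) / 4)"
proof -
  have [measurable]: "p \<in> borel_measurable M" "q \<in> borel_measurable M" "f \<in> borel_measurable M"
    using p q f by auto
  define S where "S = {s \<in> space M. q s \<le> p s}"
  have S[measurable]: "S \<in> sets M" unfolding S_def by measurable
  define I where "I = (indicator S :: 'a \<Rightarrow> real)"
  have I[measurable]: "I \<in> borel_measurable M" unfolding I_def by measurable
  have I01: "I s = 0 \<or> I s = 1" for s unfolding I_def by (auto simp: indicator_def)
  have intI: "integrable M (\<lambda>s. I s * h s)" "integrable M (\<lambda>s. (1 - I s) * h s)"
    if "integrable M h" for h :: "'a \<Rightarrow> real"
    using integrable_real_mult_indicator[OF S that] that by (auto simp: I_def algebra_simps)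
  have intf: "integrable M (\<lambda>s. f s * h s)" if h: "integrable M h" for h :: "'a \<Rightarrow> real"
  proof (rule Bochner_Integration.integrable_bound[of _ "\<lambda>s. (\<bar>c\<bar> + \<bar>\<delta>\<bar>) * h s"])
    show "AE s in M. norm (f s * h s) \<le> norm ((\<bar>c\<bar> + \<bar>\<delta>\<bar>) * h s)"
    proof (rule AE_I2)
      fix s assume "s \<in> space M"
      then have "\<bar>f s\<bar> \<le> \<bar>c\<bar> + \<bar>\<delta>\<bar>" using f(2)[of s] by auto
      then show "norm (f s * h s) \<le> norm ((\<bar>c\<bar> + \<bar>\<delta>\<bar>) * h s)"
        by (simp add: abs_mult mult_right_mono)
    qed
  qed (use h in auto)
  define P where "P = (\<integral>s. I s * p s \<partial>M)"
  define Q where "Q = (\<integral>s. I s * q s \<partial>M)"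
  have P': "(\<integral>s. (1 - I s) * p s \<partial>M) = 1 - P"
    using p intI(1)[OF p(1)] unfolding P_def left_diff_distrib by simp
  have Q': "(\<integral>s. (1 - I s) * q s \<partial>M) = 1 - Q"
    using q intI(1)[OF q(1)] unfolding Q_def left_diff_distrib by simp
  have "(\<integral>s. I s * p s * (1 - Q) \<partial>M) \<le> (\<integral>s. I s * q s * (K * (1 - P)) \<partial>M)"
  proof (rule integral_mono)
    fix s assume s: "s \<in> space M"
    \<comment> \<open>For fixed \<open>s\<close> the cross-ratio bound is integrated over
      \<open>t\<close> outside \<open>S\<close>; the outer integral over \<open>s\<close> in
      \<open>S\<close> then yields \<open>PQ\<close>.\<close>
    have "(\<integral>t. p s * ((1 - I t) * q t) \<partial>M) \<le> (\<integral>t. K * q s * ((1 - I t) * p t) \<partial>M)"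
    proof (rule integral_mono)
      fix t assume t: "t \<in> space M"
      show "p s * ((1 - I t) * q t) \<le> K * q s * ((1 - I t) * p t)"
        using I01[of t] cross[OF s t] by (auto simp: mult_ac)
    qed (use intI p q in auto)
    then have "p s * (1 - Q) \<le> K * q s * (1 - P)"
      by (simp add: P' Q')
    then show "I s * p s * (1 - Q) \<le> I s * q s * (K * (1 - P))"
      using I01[of s] by (auto simp: mult_ac)
  qed (use intI p q in auto)
  then have PQ: "P * (1 - Q) \<le> Q * (K * (1 - P))"
    by (simp add: P_def Q_def)
  have QP: "Q \<le> P"
    unfolding P_def Q_def
    by (rule integral_mono) (use intI p q in \<open>auto simp: I_def S_def indicator_def\<close>)
  have P1: "0 \<le> 1 - P"
    unfolding P'[symmetric] using I01 p(2)
    by (intro integral_nonneg_AE AE_I2) (force simp: I_def indicator_def)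
  have "P - Q \<le> (K - 1) * ((1 - P) * Q)"
    using PQ by (simp add: algebra_simps)
  also have "\<dots> \<le> (K - 1) * ((1 - P) * P)"
    using K P1 QP by (intro mult_left_mono) auto
  also have "\<dots> \<le> (K - 1) * (1 / 4)"
    using K mult_const_minus_self_real_le[of P 1] by (intro mult_left_mono) (auto simp: mult_ac)
  finally have PQ4: "P - Q \<le> (K - 1) / 4" by simp
  have "0 \<le> \<delta>" using f(2) not_empty by fastforce
  \<comment> \<open>As \<open>p\<close> and \<open>q\<close> have equal mass, \<open>f\<close> may
    be replaced by \<open>f - c\<close>, which lies in [0, \<delta>]. Then (f - c)(p - q) is at most
    \<delta> times the positive part of p - q, and that part has integral
    \<open>P - Q\<close>.\<close>
  have "(\<integral>s. f s * p s \<partial>M) - (\<integral>s. f s * q s \<partial>M)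
      = (\<integral>s. (f s * p s - f s * q s) - (c * p s - c * q s) \<partial>M)"
    using p q intf[OF p(1)] intf[OF q(1)] by simp
  also have "\<dots> \<le> (\<integral>s. \<delta> * (I s * p s - I s * q s) \<partial>M)"
  proof (rule integral_mono)
    fix s assume s: "s \<in> space M"
    have eq: "(f s * p s - f s * q s) - (c * p s - c * q s) = (f s - c) * (p s - q s)"
      by (simp add: algebra_simps)
    show "(f s * p s - f s * q s) - (c * p s - c * q s) \<le> \<delta> * (I s * p s - I s * q s)"
    proof (cases "q s \<le> p s")
      case True
      then show ?thesis
        unfolding eq using f(2)[OF s] s by (simp add: I_def S_def mult_right_mono)
    next
      case False
      then have "(f s - c) * (p s - q s) \<le> 0"
        using f(2)[OF s] by (intro mult_nonneg_nonpos) auto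
      then show ?thesis
        unfolding eq using False by (simp add: I_def S_def)
    qed
  qed (use intI intf p q in auto)
  also have "\<dots> = \<delta> * (P - Q)"
    using intI p q by (simp add: P_def Q_def)
  also have "\<dots> \<le> \<delta> * ((K - 1) / 4)"
    using PQ4 \<open>0 \<le> \<delta>\<close> by (intro mult_left_mono)
  finally show ?thesis .
qed

text \<open>Both sides of the cross-ratio bound are bilinear in \<open>p\<close> and
  \<open>q\<close>, so normalising the two weights to mass 1 preserves it with the same
  \<open>K\<close>.\<close>

lemma weighted_mean_diff_le:
  fixes p q f :: "'a \<Rightarrow> real"
  assumes p: "integrable M p" "\<And>s. s \<in> space M \<Longrightarrow> 0 \<le> p s" "0 < (\<integral>s. p s \<partial>M)"
    and q: "integrable M q" "\<And>s. s \<in> space M \<Longrightarrow> 0 \<le> q s" "0 < (\<integral>s. q s \<partial>M)"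
    and K: "1 \<le> K"
    and cross: "\<And>s t. s \<in> space M \<Longrightarrow> t \<in> space M \<Longrightarrow> p s * q t \<le> K * (p t * q s)"
    and f: "f \<in> borel_measurable M" "\<And>s. s \<in> space M \<Longrightarrow> c \<le> f s \<and> f s \<le> c + \<delta>"
  shows "(\<integral>s. f s * p s \<partial>M) / (\<integral>s. p s \<partial>M) - (\<integral>s. f s * q s \<partial>M) / (\<integral>s. q s \<partial>M)
    \<le> \<delta> * ((K - 1) / 4)"
proof -
  let ?P = "\<integral>s. p s \<partial>M" and ?Q = "\<integral>s. q s \<partial>M"
  have "(\<integral>s. f s * (p s / ?P) \<partial>M) - (\<integral>s. f s * (q s / ?Q) \<partial>M) \<le> \<delta> * ((K - 1) / 4)"
  proof (rule expectation_diff_le_of_cross_ratio[OF _ _ _ _ _ _ K _ f])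
    fix s t assume "s \<in> space M" "t \<in> space M"
    then have "(p s * q t) / (?P * ?Q) \<le> (K * (p t * q s)) / (?P * ?Q)"
      using cross p(3) q(3) by (intro divide_right_mono) auto
    then show "p s / ?P * (q t / ?Q) \<le> K * (p t / ?P * (q s / ?Q))"
      by simp
  qed (use p q in auto)
  then show ?thesis by simp
qed

text \<open>The two indices of \<open>p\<close> say whether each of two coordinates has been moved;
  \<open>s\<close> is the coordinate being integrated out. The mean of p11/p01 under the weight
  \<open>p01\<close> is the quotient of the integrals of \<open>p11\<close> and \<open>p01\<close>.
  Replacing that weight by \<open>p00\<close> costs only a relative error (K - 1)^2/4, and under
  \<open>p00\<close> the pointwise bound \<open>cross\<close> applies. The loss is of second order
  in K - 1, which is what allows many successive integrations.\<close>

lemma integral_cross_ratio: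
  fixes p00 p01 p10 p11 :: "'a \<Rightarrow> real"
  assumes meas[measurable]: "p00 \<in> borel_measurable M" "p01 \<in> borel_measurable M"
      "p10 \<in> borel_measurable M" "p11 \<in> borel_measurable M"
    and c: "0 < c"
    and bd: "\<And>s. s \<in> space M \<Longrightarrow> c \<le> p00 s \<and> p00 s \<le> C" "\<And>s. s \<in> space M \<Longrightarrow> c \<le> p01 s \<and> p01 s \<le> C"
      "\<And>s. s \<in> space M \<Longrightarrow> c \<le> p10 s \<and> p10 s \<le> C" "\<And>s. s \<in> space M \<Longrightarrow> c \<le> p11 s \<and> p11 s \<le> C"
    and K: "1 \<le> K"
    and cross: "\<And>s. s \<in> space M \<Longrightarrow> p00 s * p11 s \<le> K * (p10 s * p01 s)"
    and cross0: "\<And>s t. s \<in> space M \<Longrightarrow> t \<in> space M \<Longrightarrow> p01 s * p00 t \<le> K * (p01 t * p00 s)"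
    and cross1: "\<And>s t. s \<in> space M \<Longrightarrow> t \<in> space M \<Longrightarrow> p11 s * p01 t \<le> K * (p11 t * p01 s)"
  shows "(\<integral>s. p00 s \<partial>M) * (\<integral>s. p11 s \<partial>M)
    \<le> K * (1 + (K - 1)\<^sup>2 / 4) * ((\<integral>s. p10 s \<partial>M) * (\<integral>s. p01 s \<partial>M))"
proof -
  have int: "integrable M p00" "integrable M p01" "integrable M p10" "integrable M p11"
    using bd c by (force intro!: integrable_bounded_real[of _ C])+
  have pos: "0 < (\<integral>s. p00 s \<partial>M)" "0 < (\<integral>s. p01 s \<partial>M)"
    using integral_bounds[of p00 c C] integral_bounds[of p01 c C] bd c by auto
  define h where "h s = p11 s / p01 s" for s
  have h[measurable]: "h \<in> borel_measurable M" unfolding h_def by measurable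
  have p: "0 < p00 s" "0 < p01 s" "0 < p10 s" "0 < p11 s" if "s \<in> space M" for s
    using that bd[of s] c by auto
  have hpos: "0 < h s" if "s \<in> space M" for s using p[OF that] by (simp add: h_def)
  have hK: "h s \<le> K * h t" if "s \<in> space M" "t \<in> space M" for s t
    using cross1[OF that] p[OF that(1)] p[OF that(2)] by (simp add: h_def field_simps)
  define m where "m = Inf (h ` space M)"
  have bdd: "bdd_below (h ` space M)" using hpos by (intro bdd_belowI2[of _ 0]) force
  have m1: "m \<le> h s" if "s \<in> space M" for s
    unfolding m_def using bdd that by (rule cINF_lower)
  \<comment> \<open>\<open>cross1\<close> confines \<open>h\<close> to [m, K m]; the upper end is
    written so that the oscillation (K - 1) m is visible.\<close>
  have m2: "h s \<le> m + (K - 1) * m" if s: "s \<in> space M" for s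
  proof -
    have "h s / K \<le> m"
      unfolding m_def using not_empty hK[OF s] K by (intro cINF_greatest) (auto simp: field_simps)
    then show ?thesis using K by (simp add: field_simps)
  qed
  have m0: "0 \<le> m"
    unfolding m_def using not_empty hpos by (intro cINF_greatest) force+
  have inth: "integrable M (\<lambda>s. h s * p00 s)"
  proof (rule integrable_bounded_real)
    fix s assume s: "s \<in> space M"
    then show "\<bar>h s * p00 s\<bar> \<le> (m + (K - 1) * m) * C"
      using hpos[OF s] p[OF s] m2[OF s] bd(1)[OF s] by (auto simp: abs_mult intro!: mult_mono)
  qed measurable
  let ?E = "(\<integral>s. h s * p00 s \<partial>M) / (\<integral>s. p00 s \<partial>M)"
  have "m * (\<integral>s. p00 s \<partial>M) = (\<integral>s. m * p00 s \<partial>M)" using int by simp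
  also have "\<dots> \<le> (\<integral>s. h s * p00 s \<partial>M)"
    by (rule integral_mono) (use int inth m1 p in \<open>auto intro!: mult_right_mono less_imp_le\<close>)
  finally have mE: "m \<le> ?E" using pos by (simp add: field_simps)
  have h01: "(\<integral>s. h s * p01 s \<partial>M) = (\<integral>s. p11 s \<partial>M)"
    using p by (intro Bochner_Integration.integral_cong) (auto simp: h_def less_imp_neq[symmetric])
  have "(\<integral>s. p11 s \<partial>M) / (\<integral>s. p01 s \<partial>M) - ?E \<le> ((K - 1) * m) * ((K - 1) / 4)"
    unfolding h01[symmetric]
    by (rule weighted_mean_diff_le[where c = m])
      (use int pos K cross0 m1 m2 p in \<open>auto intro: less_imp_le\<close>)
  also have "\<dots> = m * ((K - 1)\<^sup>2 / 4)" by (simp add: power2_eq_square)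
  \<comment> \<open>The infimum \<open>m\<close> is at most the mean, which turns the absolute error
    into a relative one.\<close>
  also have "\<dots> \<le> ?E * ((K - 1)\<^sup>2 / 4)" using mE by (intro mult_right_mono) auto
  finally have "(\<integral>s. p11 s \<partial>M) / (\<integral>s. p01 s \<partial>M) \<le> (1 + (K - 1)\<^sup>2 / 4) * ?E"
    by (simp add: algebra_simps)
  then have "(\<integral>s. p11 s \<partial>M) * (\<integral>s. p00 s \<partial>M)
      \<le> (1 + (K - 1)\<^sup>2 / 4) * (\<integral>s. h s * p00 s \<partial>M) * (\<integral>s. p01 s \<partial>M)"
    using pos by (simp add: field_simps)
  also have "\<dots> \<le> (1 + (K - 1)\<^sup>2 / 4) * (K * (\<integral>s. p10 s \<partial>M)) * (\<integral>s. p01 s \<partial>M)"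
  proof (intro mult_right_mono mult_left_mono)
    have "(\<integral>s. h s * p00 s \<partial>M) \<le> (\<integral>s. K * p10 s \<partial>M)"
    proof (rule integral_mono)
      fix s assume s: "s \<in> space M"
      show "h s * p00 s \<le> K * p10 s"
        using cross[OF s] p[OF s] by (simp add: h_def field_simps)
    qed (use int inth in auto)
    then show "(\<integral>s. h s * p00 s \<partial>M) \<le> K * (\<integral>s. p10 s \<partial>M)" by simp
  qed (use pos in auto)
  finally show ?thesis by (simp add: mult_ac)
qed


text \<open>This is Hoeffding's lemma for the probability measure with density p/Z. Keeping the
  weight unnormalised lets it be applied to each fibre of a joint density, with the marginal as
  total mass.\<close>

lemma weighted_Hoeffdings_lemma:
  fixes p f :: "'a \<Rightarrow> real"
  assumes p: "integrable M p" "\<And>s. s \<in> space M \<Longrightarrow> 0 \<le> p s" "0 < (\<integral>s. p s \<partial>M)"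
    and f: "f \<in> borel_measurable M" "\<And>s. s \<in> space M \<Longrightarrow> c \<le> f s \<and> f s \<le> c + \<delta>"
    and l: "0 < l"
  shows "(\<integral>s. exp (l * (f s - (\<integral>s. f s * p s \<partial>M) / (\<integral>s. p s \<partial>M))) * p s \<partial>M)
    \<le> exp (l\<^sup>2 * \<delta>\<^sup>2 / 8) * (\<integral>s. p s \<partial>M)"
proof -
  have [measurable]: "p \<in> borel_measurable M" "f \<in> borel_measurable M"
    using p f by auto
  define Z where "Z = (\<integral>s. p s \<partial>M)"
  define D where "D = density M (\<lambda>s. ennreal (p s / Z))"
  have Z: "0 < Z" using p unfolding Z_def by simp
  have nn: "AE s in M. 0 \<le> p s / Z" using p(2) Z by auto
  have "emeasure D (space D) = (\<integral>\<^sup>+s. ennreal (p s / Z) \<partial>M)"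
    unfolding D_def by (simp add: emeasure_density cong: nn_integral_cong_simp)
  also have "\<dots> = ennreal (\<integral>s. p s / Z \<partial>M)"
    by (intro nn_integral_eq_integral nn) (use p in auto)
  also have "\<dots> = 1" using Z by (simp add: Z_def)
  finally interpret D: prob_space D by (rule prob_spaceI)
  have sp: "space D = space M" by (simp add: D_def)
  interpret interval_bounded_random_variable D f c "c + \<delta>"
    by unfold_locales (use f(2) in \<open>auto simp: D_def AE_density\<close>)
  have intD: "(\<integral>s. h s \<partial>D) = (\<integral>s. h s * p s \<partial>M) / Z" if "h \<in> borel_measurable M" for h :: "'a \<Rightarrow> real"
  proof -
    have "(\<integral>s. h s \<partial>D) = (\<integral>s. p s / Z * h s \<partial>M)"
      unfolding D_def using that nn by (subst integral_density) auto
    also have "\<dots> = (\<integral>s. h s * p s / Z \<partial>M)" by (simp add: mult_ac)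
    finally show ?thesis by simp
  qed
  define E where "E = (\<integral>s. f s \<partial>D)"
  have E: "E = (\<integral>s. f s * p s \<partial>M) / (\<integral>s. p s \<partial>M)"
    using intD[of f] f(1) unfolding E_def Z_def by simp
  have int: "integrable D (\<lambda>s. exp (l * (f s - E)))"
  proof (rule D.integrable_bounded_real)
    fix s assume "s \<in> space D"
    then show "\<bar>exp (l * (f s - E))\<bar> \<le> exp (l * (c + \<delta> - E))"
      using f(2)[of s] l by (simp add: sp)
  qed (simp add: D_def)
  have "ennreal (\<integral>s. exp (l * (f s - E)) \<partial>D) = (\<integral>\<^sup>+s. ennreal (exp (l * (f s - E))) \<partial>D)"
    using int by (subst nn_integral_eq_integral) auto
  also have "\<dots> \<le> ennreal (exp (l\<^sup>2 * \<delta>\<^sup>2 / 8))"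
    using Hoeffdings_lemma_nn_integral[OF l] by (simp add: E_def)
  finally have "(\<integral>s. exp (l * (f s - E)) \<partial>D) \<le> exp (l\<^sup>2 * \<delta>\<^sup>2 / 8)"
    by simp
  then have "(\<integral>s. exp (l * (f s - E)) * p s \<partial>M) \<le> exp (l\<^sup>2 * \<delta>\<^sup>2 / 8) * Z"
    using Z by (subst (asm) intD) (auto simp: field_simps)
  then show ?thesis unfolding E Z_def .
qed

section \<open>Integrating out coordinates\<close>

abbreviation cube :: "nat \<Rightarrow> (nat \<Rightarrow> 'a) measure" where
  "cube k \<equiv> PiM {..<k} (\<lambda>_. M)"

text \<open>A discrete form of a bound on the mixed second derivatives of log \<rho>: its mixed
  second differences are at most log K. Exchanging \<open>x\<close> with \<open>x(i := u)\<close>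
  gives the reciprocal bound too. The uniform bounds \<open>c\<close> and \<open>C\<close> make the
  integrals finite and the marginals positive.\<close>

definition cross_ratio_bounded :: "real \<Rightarrow> nat \<Rightarrow> ((nat \<Rightarrow> 'a) \<Rightarrow> real) \<Rightarrow> bool" where
  "cross_ratio_bounded K k \<rho> \<longleftrightarrow> \<rho> \<in> borel_measurable (cube k) \<and>
     (\<exists>c>0. \<exists>C. \<forall>x\<in>space (cube k). c \<le> \<rho> x \<and> \<rho> x \<le> C) \<and>
     (\<forall>x\<in>space (cube k). \<forall>i<k. \<forall>j<k. i \<noteq> j \<longrightarrow> (\<forall>u\<in>space M. \<forall>v\<in>space M.
        \<rho> x * \<rho> (x(i := u, j := v)) \<le> K * (\<rho> (x(i := u)) * \<rho> (x(j := v)))))"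

definition osc_bounded :: "real \<Rightarrow> nat \<Rightarrow> ((nat \<Rightarrow> 'a) \<Rightarrow> real) \<Rightarrow> bool" where
  "osc_bounded \<delta> k g \<longleftrightarrow> g \<in> borel_measurable (cube k) \<and>
     (\<exists>B. \<forall>x\<in>space (cube k). \<bar>g x\<bar> \<le> B) \<and>
     (\<forall>x\<in>space (cube k). \<forall>j<k. \<forall>u\<in>space M. \<bar>g (x(j := u)) - g x\<bar> \<le> \<delta>)"

definition marginal :: "nat \<Rightarrow> ((nat \<Rightarrow> 'a) \<Rightarrow> real) \<Rightarrow> (nat \<Rightarrow> 'a) \<Rightarrow> real" where
  "marginal k \<rho> x = (\<integral>s. \<rho> (x(k := s)) \<partial>M)"

text \<open>The conditional expectation of \<open>g\<close> given the coordinates below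
  \<open>k\<close>, for the measure on the cube of dimension \<open>Suc k\<close> with density
  proportional to \<rho>.\<close>

definition fiber_mean ::
  "nat \<Rightarrow> ((nat \<Rightarrow> 'a) \<Rightarrow> real) \<Rightarrow> ((nat \<Rightarrow> 'a) \<Rightarrow> real) \<Rightarrow> (nat \<Rightarrow> 'a) \<Rightarrow> real" where
  "fiber_mean k \<rho> g x = (\<integral>s. g (x(k := s)) * \<rho> (x(k := s)) \<partial>M) / marginal k \<rho> x"

section \<open>Cubes: coordinate changes, fibres, Fubini, and stability under integrating
  out\<close>

lemma cube_upd:
  assumes "x \<in> space (cube k)" "j < k" "u \<in> space M"
  shows "x(j := u) \<in> space (cube k)"
  using assms by (auto simp: space_PiM PiE_def extensional_def)

lemma cube_Suc_upd:
  assumes "x \<in> space (cube k)" "u \<in> space M"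
  shows "x(k := u) \<in> space (cube (Suc k))"
  using assms by (auto simp: space_PiM PiE_def extensional_def less_Suc_eq Pi_iff)

lemma cube_coord:
  assumes "x \<in> space (cube k)" "j < k"
  shows "x j \<in> space M"
  using assms by (auto simp: space_PiM)

lemma measurable_fiber:
  assumes "f \<in> borel_measurable (cube (Suc k))" "x \<in> space (cube k)"
  shows "(\<lambda>s. f (x(k := s))) \<in> borel_measurable M"
proof -
  have "(\<lambda>s. x(k := s)) \<in> measurable M (PiM (insert k {..<k}) (\<lambda>_. M))"
    using assms(2) by (intro measurable_fun_upd[where J = "{..<k}"]) auto
  then show ?thesis
    using assms(1) unfolding lessThan_Suc by (rule measurable_compose)
qed

lemma measurable_integral_fiber:
  fixes f :: "(nat \<Rightarrow> 'a) \<Rightarrow> real"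
  assumes [measurable]: "f \<in> borel_measurable (cube (Suc k))"
  shows "(\<lambda>x. \<integral>s. f (x(k := s)) \<partial>M) \<in> borel_measurable (cube k)"
proof -
  have "(\<lambda>(x, s). x(k := s)) \<in> measurable (cube k \<Otimes>\<^sub>M M) (cube (Suc k))"
    using measurable_add_dim[of k "{..<k}" "\<lambda>_. M"] by (simp add: lessThan_Suc)
  then have "(\<lambda>z. f ((\<lambda>(x, s). x(k := s)) z)) \<in> borel_measurable (cube k \<Otimes>\<^sub>M M)"
    using assms by (rule measurable_compose)
  then show ?thesis
    by (intro borel_measurable_lebesgue_integral) (simp add: case_prod_beta')
qed

lemma prob_space_cube: "prob_space (cube k)"
  by (intro prob_space_PiM prob_space_axioms)

lemma integrable_cube:
  fixes f :: "(nat \<Rightarrow> 'a) \<Rightarrow> real"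
  assumes "f \<in> borel_measurable (cube k)" "\<And>x. x \<in> space (cube k) \<Longrightarrow> \<bar>f x\<bar> \<le> B"
  shows "integrable (cube k) f"
  using prob_space.integrable_bounded_real[OF prob_space_cube assms] .

lemma integral_cube_Suc:
  fixes f :: "(nat \<Rightarrow> 'a) \<Rightarrow> real"
  assumes "integrable (cube (Suc k)) f"
  shows "(\<integral>x. f x \<partial>cube (Suc k)) = (\<integral>x. (\<integral>s. f (x(k := s)) \<partial>M) \<partial>cube k)"
proof -
  interpret product_sigma_finite "\<lambda>_::nat. M" by unfold_locales
  show ?thesis
    using product_integral_insert[of "{..<k}" k f] assms by (simp add: lessThan_Suc)
qed

text \<open>\<open>integral_cross_ratio\<close> is applied with the fibre variable in coordinate
  \<open>k\<close>. The cross ratio in (i, j) is used at a fixed fibre point; those in (j, k) and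
  (i, k) compare the weights along the fibre.\<close>

lemma cross_ratio_bounded_marginal:
  assumes \<rho>: "cross_ratio_bounded K (Suc k) \<rho>" and K: "1 \<le> K"
  shows "cross_ratio_bounded (K * (1 + (K - 1)\<^sup>2 / 4)) k (marginal k \<rho>)"
proof -
  from \<rho> obtain c C where c: "0 < c" and
    bd: "\<And>x. x \<in> space (cube (Suc k)) \<Longrightarrow> c \<le> \<rho> x \<and> \<rho> x \<le> C"
    unfolding cross_ratio_bounded_def by blast
  have meas: "\<rho> \<in> borel_measurable (cube (Suc k))"
    using \<rho> unfolding cross_ratio_bounded_def by blast
  have cr: "\<rho> x * \<rho> (x(i := u, j := v)) \<le> K * (\<rho> (x(i := u)) * \<rho> (x(j := v)))"
    if "x \<in> space (cube (Suc k))" "i < Suc k" "j < Suc k" "i \<noteq> j" "u \<in> space M" "v \<in> space M" for x i j u v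
    using \<rho> that unfolding cross_ratio_bounded_def by blast
  have "c \<le> marginal k \<rho> x \<and> marginal k \<rho> x \<le> C" if x: "x \<in> space (cube k)" for x
    unfolding marginal_def
    by (rule integral_bounds[OF measurable_fiber[OF meas x]]) (rule bd[OF cube_Suc_upd[OF x]])
  moreover have "marginal k \<rho> x * marginal k \<rho> (x(i := u, j := v))
      \<le> K * (1 + (K - 1)\<^sup>2 / 4) * (marginal k \<rho> (x(i := u)) * marginal k \<rho> (x(j := v)))"
    if x: "x \<in> space (cube k)" and ij: "i < k" "j < k" "i \<noteq> j" and u: "u \<in> space M" and v: "v \<in> space M"
    for x i j u v
  proof -
    have xs: "x(i := u) \<in> space (cube k)" "x(j := v) \<in> space (cube k)" "x(i := u, j := v) \<in> space (cube k)"
      using x ij u v by (auto intro!: cube_upd)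
    show ?thesis
      unfolding marginal_def
    proof (rule integral_cross_ratio[OF _ _ _ _ c _ _ _ _ K])
      fix s assume s: "s \<in> space M"
      show "\<rho> (x(k := s)) * \<rho> (x(i := u, j := v, k := s)) \<le> K * (\<rho> (x(i := u, k := s)) * \<rho> (x(j := v, k := s)))"
        using cr[OF cube_Suc_upd[OF x s], of i j u v] ij u v
        by (simp add: fun_upd_twist[of k i] fun_upd_twist[of k j])
      fix t assume t: "t \<in> space M"
      show "\<rho> (x(j := v, k := s)) * \<rho> (x(k := t)) \<le> K * (\<rho> (x(j := v, k := t)) * \<rho> (x(k := s)))"
        \<comment> \<open>The base point already has \<open>v\<close> in coordinate
          \<open>j\<close>; moving that coordinate back to \<open>x j\<close> recovers
          \<open>x\<close>.\<close>
        using cr[OF cube_Suc_upd[OF xs(2) s], of j k "x j" t] ij t cube_coord[OF x ij(2)]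
        by (simp add: fun_upd_twist[of k j] mult_ac)
      show "\<rho> (x(i := u, j := v, k := s)) * \<rho> (x(j := v, k := t))
          \<le> K * (\<rho> (x(i := u, j := v, k := t)) * \<rho> (x(j := v, k := s)))"
        using cr[OF cube_Suc_upd[OF xs(3) s], of i k "x i" t] ij t cube_coord[OF x ij(1)]
        by (simp add: fun_upd_twist[of k i] fun_upd_twist[of j i] mult_ac)
    qed (use bd x xs in \<open>auto intro: cube_Suc_upd intro!: measurable_fiber[OF meas]\<close>)
  qed
  ultimately show ?thesis
    using c measurable_integral_fiber[OF meas]
    unfolding cross_ratio_bounded_def by (auto simp: marginal_def[abs_def])
qed

text \<open>Changing coordinate \<open>j\<close> changes the integrand by at most \<delta>. It also
  changes the weight on the fibre, which costs at most \<delta> (K - 1)/4, because \<open>g\<close>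
  varies by at most \<delta> along the fibre.\<close>

lemma osc_bounded_fiber_mean:
  assumes \<rho>: "cross_ratio_bounded K (Suc k) \<rho>" and K: "1 \<le> K"
    and g: "osc_bounded \<delta> (Suc k) g"
  shows "osc_bounded (\<delta> * (1 + (K - 1) / 4)) k (fiber_mean k \<rho> g)"
proof -
  from \<rho> obtain c C where c: "0 < c" and
    bd: "\<And>x. x \<in> space (cube (Suc k)) \<Longrightarrow> c \<le> \<rho> x \<and> \<rho> x \<le> C"
    unfolding cross_ratio_bounded_def by blast
  have meas[measurable]: "\<rho> \<in> borel_measurable (cube (Suc k))" "g \<in> borel_measurable (cube (Suc k))"
    using \<rho> g unfolding cross_ratio_bounded_def osc_bounded_def by blast+
  have cr: "\<rho> x * \<rho> (x(i := u, j := v)) \<le> K * (\<rho> (x(i := u)) * \<rho> (x(j := v)))"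
    if "x \<in> space (cube (Suc k))" "i < Suc k" "j < Suc k" "i \<noteq> j" "u \<in> space M" "v \<in> space M" for x i j u v
    using \<rho> that unfolding cross_ratio_bounded_def by blast
  from g obtain B where B: "\<And>x. x \<in> space (cube (Suc k)) \<Longrightarrow> \<bar>g x\<bar> \<le> B"
    unfolding osc_bounded_def by blast
  have osc: "\<bar>g (x(j := u)) - g x\<bar> \<le> \<delta>"
    if "x \<in> space (cube (Suc k))" "j < Suc k" "u \<in> space M" for x j u
    using g that unfolding osc_bounded_def by blast
  have mf: "(\<lambda>s. \<rho> (x(k := s))) \<in> borel_measurable M" "(\<lambda>s. g (x(k := s))) \<in> borel_measurable M"
    if "x \<in> space (cube k)" for x
    using that by (intro measurable_fiber meas; assumption)+
  have mb: "c \<le> marginal k \<rho> x \<and> marginal k \<rho> x \<le> C" if x: "x \<in> space (cube k)" for x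
    unfolding marginal_def
    by (rule integral_bounds[OF measurable_fiber[OF meas(1) x]]) (rule bd[OF cube_Suc_upd[OF x]])
  have int\<rho>: "integrable M (\<lambda>s. \<rho> (x(k := s)))" if x: "x \<in> space (cube k)" for x
    using bd[OF cube_Suc_upd[OF x]] c
    by (intro integrable_bounded_real[of _ C] mf[OF x]) force
  have intg: "integrable M (\<lambda>s. g (y(k := s)) * \<rho> (x(k := s)))"
    if x: "x \<in> space (cube k)" and y: "y \<in> space (cube k)" for x y
  proof (rule integrable_bounded_real[of _ "B * C"])
    fix s assume s: "s \<in> space M"
    show "\<bar>g (y(k := s)) * \<rho> (x(k := s))\<bar> \<le> B * C"
      using B[OF cube_Suc_upd[OF y s]] bd[OF cube_Suc_upd[OF x s]] c
      by (auto simp: abs_mult intro!: mult_mono)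
  qed (use mf[OF x] mf[OF y] in simp)
  have fb: "\<bar>fiber_mean k \<rho> g x\<bar> \<le> B" if x: "x \<in> space (cube k)" for x
  proof -
    have "\<bar>\<integral>s. g (x(k := s)) * \<rho> (x(k := s)) \<partial>M\<bar> \<le> (\<integral>s. \<bar>g (x(k := s)) * \<rho> (x(k := s))\<bar> \<partial>M)"
      by (rule integral_abs_bound)
    also have "\<dots> \<le> (\<integral>s. B * \<rho> (x(k := s)) \<partial>M)"
    proof (rule integral_mono)
      fix s assume s: "s \<in> space M"
      show "\<bar>g (x(k := s)) * \<rho> (x(k := s))\<bar> \<le> B * \<rho> (x(k := s))"
        using B[OF cube_Suc_upd[OF x s]] bd[OF cube_Suc_upd[OF x s]] c
        by (auto simp: abs_mult intro!: mult_mono)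
    qed (use intg[OF x x] int\<rho>[OF x] in auto)
    also have "\<dots> = B * marginal k \<rho> x" by (simp add: marginal_def)
    finally show ?thesis
      unfolding fiber_mean_def using mb[OF x] c by (simp add: field_simps)
  qed
  have one_sided: "fiber_mean k \<rho> g (x(j := u)) - fiber_mean k \<rho> g x \<le> \<delta> * (1 + (K - 1) / 4)"
    if x: "x \<in> space (cube k)" and j: "j < k" and u: "u \<in> space M" for x j u
  proof -
    have y: "x(j := u) \<in> space (cube k)" using x j u by (rule cube_upd)
    let ?m = "marginal k \<rho> (x(j := u))"
    \<comment> \<open>The intermediate mean has the old integrand and the new weight, which
      separates the two effects.\<close>
    let ?h = "(\<integral>s. g (x(k := s)) * \<rho> (x(j := u, k := s)) \<partial>M) / ?m"
    have m: "0 < ?m" using mb[OF y] c by simp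
    have "(\<integral>s. g (x(j := u, k := s)) * \<rho> (x(j := u, k := s)) \<partial>M)
        \<le> (\<integral>s. \<delta> * \<rho> (x(j := u, k := s)) + g (x(k := s)) * \<rho> (x(j := u, k := s)) \<partial>M)"
    proof (rule integral_mono)
      fix s assume s: "s \<in> space M"
      have "g (x(j := u, k := s)) \<le> \<delta> + g (x(k := s))"
        using osc[OF cube_Suc_upd[OF x s], of j u] j u by (simp add: fun_upd_twist[of k j])
      then have "g (x(j := u, k := s)) * \<rho> (x(j := u, k := s)) \<le> (\<delta> + g (x(k := s))) * \<rho> (x(j := u, k := s))"
        using bd[OF cube_Suc_upd[OF y s]] c by (intro mult_right_mono) auto
      then show "g (x(j := u, k := s)) * \<rho> (x(j := u, k := s))
          \<le> \<delta> * \<rho> (x(j := u, k := s)) + g (x(k := s)) * \<rho> (x(j := u, k := s))"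
        by (simp add: algebra_simps)
    qed (use intg[OF y y] intg[OF y x] int\<rho>[OF y] in auto)
    also have "\<dots> = \<delta> * ?m + (\<integral>s. g (x(k := s)) * \<rho> (x(j := u, k := s)) \<partial>M)"
      using intg[OF y x] int\<rho>[OF y] by (simp add: marginal_def)
    finally have 1: "fiber_mean k \<rho> g (x(j := u)) \<le> \<delta> + ?h"
      unfolding fiber_mean_def using m by (simp add: field_simps)
    have "g (x(k := s)) - g (x(k := t)) \<le> \<delta>" if s: "s \<in> space M" and t: "t \<in> space M" for s t
      using osc[OF cube_Suc_upd[OF x t], of k s] s by simp
    then obtain c' where c': "\<And>s. s \<in> space M \<Longrightarrow> c' \<le> g (x(k := s)) \<and> g (x(k := s)) \<le> c' + \<delta>"
      using interval_of_pairwise_diff_le[of "space M" "\<lambda>s. g (x(k := s))" \<delta>] by blast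
    have 2: "?h - fiber_mean k \<rho> g x \<le> \<delta> * ((K - 1) / 4)"
      unfolding fiber_mean_def marginal_def
    proof (rule weighted_mean_diff_le[OF _ _ _ _ _ _ K])
      fix s t assume s: "s \<in> space M" and t: "t \<in> space M"
      show "\<rho> (x(j := u, k := s)) * \<rho> (x(k := t)) \<le> K * (\<rho> (x(j := u, k := t)) * \<rho> (x(k := s)))"
        using cr[OF cube_Suc_upd[OF y s], of j k "x j" t] j t cube_coord[OF x j]
        by (simp add: fun_upd_twist[of k j] mult_ac)
    next
      fix s assume s: "s \<in> space M"
      show "0 \<le> \<rho> (x(j := u, k := s))" "0 \<le> \<rho> (x(k := s))"
        using bd[OF cube_Suc_upd[OF y s]] bd[OF cube_Suc_upd[OF x s]] c by auto
      show "c' \<le> g (x(k := s)) \<and> g (x(k := s)) \<le> c' + \<delta>" by (rule c'[OF s])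
    qed (use mb[OF x] mb[OF y] c mf[OF x] int\<rho>[OF x] int\<rho>[OF y] in \<open>auto simp: marginal_def\<close>)
    have "\<delta> * (1 + (K - 1) / 4) = \<delta> + \<delta> * ((K - 1) / 4)" by (simp add: distrib_left)
    with 1 2 show ?thesis by linarith
  qed
  have "\<bar>fiber_mean k \<rho> g (x(j := u)) - fiber_mean k \<rho> g x\<bar> \<le> \<delta> * (1 + (K - 1) / 4)"
    if x: "x \<in> space (cube k)" and j: "j < k" and u: "u \<in> space M" for x j u
    using one_sided[OF x j u] one_sided[OF cube_upd[OF x j u] j cube_coord[OF x j]] by simp
  moreover have "fiber_mean k \<rho> g \<in> borel_measurable (cube k)"
    unfolding fiber_mean_def[abs_def] marginal_def
    by (intro borel_measurable_divide measurable_integral_fiber) measurable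
  ultimately show ?thesis
    unfolding osc_bounded_def using fb by blast
qed

text \<open>Induction peels off the last coordinate: Hoeffding's lemma on the fibre contributes
  \<delta>^2, and the conditional mean under the marginal remains. The number \<open>q\<close> is a
  ceiling for the cross-ratio excess \<kappa>; the term 3/10 k q^2 reserves room for its growth over
  the \<open>k\<close> remaining integrations. The factor (1 + q/4)^k accounts for the growth of the
  oscillation.\<close>

lemma integral_exp_deviation_le:
  fixes q l :: real
  assumes q: "0 \<le> q" "q \<le> 1 / 5" and l: "0 < l"
  shows "\<lbrakk>0 \<le> \<kappa>; \<kappa> + 3 / 10 * real k * q\<^sup>2 \<le> q; cross_ratio_bounded (1 + \<kappa>) k \<rho>;
      osc_bounded \<delta> k g; 0 \<le> \<delta>\<rbrakk> \<Longrightarrow>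
    (\<integral>x. exp (l * (g x - (\<integral>x. g x * \<rho> x \<partial>cube k) / (\<integral>x. \<rho> x \<partial>cube k))) * \<rho> x \<partial>cube k)
      \<le> exp (l\<^sup>2 * (real k * (\<delta> * (1 + q / 4) ^ k)\<^sup>2) / 8) * (\<integral>x. \<rho> x \<partial>cube k)"
proof (induction k arbitrary: \<kappa> \<rho> \<delta> g)
  case 0
  \<comment> \<open>The cube of dimension 0 has a single point, where \<open>g\<close> equals its
    mean.\<close>
  from "0.prems"(3) have "0 < \<rho> (\<lambda>_. undefined)"
    unfolding cross_ratio_bounded_def by (force simp: space_PiM)
  then show ?case
    by (simp add: PiM_empty lebesgue_integral_count_space_finite)
next
  case (Suc k)
  note \<rho> = Suc.prems(3) and g = Suc.prems(4)
  from \<rho> obtain c C where c: "0 < c" and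
    bd: "\<And>x. x \<in> space (cube (Suc k)) \<Longrightarrow> c \<le> \<rho> x \<and> \<rho> x \<le> C"
    unfolding cross_ratio_bounded_def by blast
  from g obtain B where B: "\<And>x. x \<in> space (cube (Suc k)) \<Longrightarrow> \<bar>g x\<bar> \<le> B"
    unfolding osc_bounded_def by blast
  have meas[measurable]: "\<rho> \<in> borel_measurable (cube (Suc k))" "g \<in> borel_measurable (cube (Suc k))"
    using \<rho> g unfolding cross_ratio_bounded_def osc_bounded_def by blast+
  have osc: "\<bar>g (x(j := u)) - g x\<bar> \<le> \<delta>"
    if "x \<in> space (cube (Suc k))" "j < Suc k" "u \<in> space M" for x j u
    using g that unfolding osc_bounded_def by blast
  define \<rho>' where "\<rho>' = marginal k \<rho>"
  define g' where "g' = fiber_mean k \<rho> g"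
  define \<kappa>' where "\<kappa>' = \<kappa> + \<kappa>\<^sup>2 * (1 + \<kappa>) / 4"
  have "(1 + \<kappa>) * (1 + (1 + \<kappa> - 1)\<^sup>2 / 4) = 1 + \<kappa>'"
    by (simp add: \<kappa>'_def field_simps power2_eq_square)
  then have \<rho>': "cross_ratio_bounded (1 + \<kappa>') k \<rho>'"
    using cross_ratio_bounded_marginal[OF \<rho>] Suc.prems(1) by (simp add: \<rho>'_def)
  have g': "osc_bounded (\<delta> * (1 + \<kappa> / 4)) k g'"
    using osc_bounded_fiber_mean[OF \<rho> _ g] Suc.prems(1) by (simp add: g'_def)
  have "0 \<le> 3 / 10 * real (Suc k) * q\<^sup>2" by simp
  then have \<kappa>q: "\<kappa> \<le> q" using Suc.prems(2) by linarith
  \<comment> \<open>Here \<kappa> \<le> q \<le> 1/5. Dividing by 4 shows that one integration raises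
    \<kappa> by at most 3/10 q^2, exactly the share reserved for it.\<close>
  have "\<kappa>\<^sup>2 * (1 + \<kappa>) \<le> q\<^sup>2 * (6 / 5)"
    using \<kappa>q q Suc.prems(1) by (intro mult_mono power_mono) auto
  then have "\<kappa>' + 3 / 10 * real k * q\<^sup>2 \<le> \<kappa> + 3 / 10 * real (Suc k) * q\<^sup>2"
    by (simp add: \<kappa>'_def algebra_simps)
  then have \<kappa>'q: "\<kappa>' + 3 / 10 * real k * q\<^sup>2 \<le> q" "0 \<le> \<kappa>'"
    using Suc.prems(1) order_trans[OF _ Suc.prems(2)] by (auto simp: \<kappa>'_def)
  have int\<rho>: "integrable (cube (Suc k)) \<rho>"
    using bd c by (intro integrable_cube[of _ _ C]) force+
  have intg\<rho>: "integrable (cube (Suc k)) (\<lambda>x. g x * \<rho> x)"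
  proof (rule integrable_cube[of _ _ "B * C"])
    fix x assume x: "x \<in> space (cube (Suc k))"
    show "\<bar>g x * \<rho> x\<bar> \<le> B * C"
      using B[OF x] bd[OF x] c by (auto simp: abs_mult intro!: mult_mono)
  qed measurable
  define E where "E = (\<integral>x. g x * \<rho> x \<partial>cube (Suc k)) / (\<integral>x. \<rho> x \<partial>cube (Suc k))"
  have int_exp: "integrable (cube (Suc k)) (\<lambda>x. exp (l * (g x - E)) * \<rho> x)"
  proof (rule integrable_cube[of _ _ "exp (l * (B - E)) * C"])
    fix x assume x: "x \<in> space (cube (Suc k))"
    have "exp (l * (g x - E)) \<le> exp (l * (B - E))"
      using B[OF x] l by simp
    then show "\<bar>exp (l * (g x - E)) * \<rho> x\<bar> \<le> exp (l * (B - E)) * C"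
      using bd[OF x] c by (auto simp: abs_mult intro!: mult_mono)
  qed measurable
  have marg: "c \<le> \<rho>' x \<and> \<rho>' x \<le> C" if x: "x \<in> space (cube k)" for x
    unfolding marginal_def \<rho>'_def
    by (rule integral_bounds[OF measurable_fiber[OF meas(1) x]]) (rule bd[OF cube_Suc_upd[OF x]])
  \<comment> \<open>The tower property: \<open>g'\<close> under \<open>\<rho>'\<close> has the same
    mean \<open>E\<close> as \<open>g\<close> under \<rho>, so the induction hypothesis is centred
    correctly.\<close>
  have "(\<integral>x. g x * \<rho> x \<partial>cube (Suc k)) = (\<integral>x. g' x * \<rho>' x \<partial>cube k)"
    unfolding integral_cube_Suc[OF intg\<rho>]
  proof (rule Bochner_Integration.integral_cong[OF refl])
    fix x assume "x \<in> space (cube k)"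
    then have "\<rho>' x \<noteq> 0" using marg[of x] c by auto
    then show "(\<integral>s. g (x(k := s)) * \<rho> (x(k := s)) \<partial>M) = g' x * \<rho>' x"
      by (simp add: g'_def fiber_mean_def \<rho>'_def)
  qed
  moreover have int\<rho>': "(\<integral>x. \<rho> x \<partial>cube (Suc k)) = (\<integral>x. \<rho>' x \<partial>cube k)"
    unfolding integral_cube_Suc[OF int\<rho>] by (simp add: \<rho>'_def marginal_def)
  ultimately have E: "E = (\<integral>x. g' x * \<rho>' x \<partial>cube k) / (\<integral>x. \<rho>' x \<partial>cube k)"
    by (simp add: E_def)
  have [measurable]: "\<rho>' \<in> borel_measurable (cube k)" "g' \<in> borel_measurable (cube k)"
    using \<rho>' g' unfolding cross_ratio_bounded_def osc_bounded_def by blast+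
  from g' obtain B' where B': "\<And>x. x \<in> space (cube k) \<Longrightarrow> \<bar>g' x\<bar> \<le> B'"
    unfolding osc_bounded_def by blast
  have int_exp': "integrable (cube k) (\<lambda>x. exp (l * (g' x - E)) * \<rho>' x)"
  proof (rule integrable_cube[of _ _ "exp (l * (B' - E)) * C"])
    fix x assume x: "x \<in> space (cube k)"
    have "exp (l * (g' x - E)) \<le> exp (l * (B' - E))"
      using B'[OF x] l by simp
    then show "\<bar>exp (l * (g' x - E)) * \<rho>' x\<bar> \<le> exp (l * (B' - E)) * C"
      using marg[OF x] c by (auto simp: abs_mult intro!: mult_mono)
  qed measurable
  \<comment> \<open>Write g - E as (g - g') + (g' - E). The second term is constant on the fibre,
    and the first is centred there.\<close>
  have fiber: "(\<integral>s. exp (l * (g (x(k := s)) - E)) * \<rho> (x(k := s)) \<partial>M)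
      \<le> exp (l\<^sup>2 * \<delta>\<^sup>2 / 8) * (exp (l * (g' x - E)) * \<rho>' x)" if x: "x \<in> space (cube k)" for x
  proof -
    have "g (x(k := s)) - g (x(k := t)) \<le> \<delta>" if s: "s \<in> space M" and t: "t \<in> space M" for s t
      using osc[OF cube_Suc_upd[OF x t], of k s] s by simp
    then obtain c' where c': "\<And>s. s \<in> space M \<Longrightarrow> c' \<le> g (x(k := s)) \<and> g (x(k := s)) \<le> c' + \<delta>"
      using interval_of_pairwise_diff_le[of "space M" "\<lambda>s. g (x(k := s))" \<delta>] by blast
    have H: "(\<integral>s. exp (l * (g (x(k := s)) - g' x)) * \<rho> (x(k := s)) \<partial>M)
        \<le> exp (l\<^sup>2 * \<delta>\<^sup>2 / 8) * \<rho>' x"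
      unfolding g'_def fiber_mean_def \<rho>'_def marginal_def
    proof (rule weighted_Hoeffdings_lemma[OF _ _ _ _ c' l])
      show "integrable M (\<lambda>s. \<rho> (x(k := s)))"
        using bd[OF cube_Suc_upd[OF x]] c
        by (intro integrable_bounded_real[of _ C] measurable_fiber[OF meas(1) x]) force
      show "0 < (\<integral>s. \<rho> (x(k := s)) \<partial>M)"
        using marg[OF x] c by (simp add: \<rho>'_def marginal_def)
      show "0 \<le> \<rho> (x(k := s))" if "s \<in> space M" for s
        using bd[OF cube_Suc_upd[OF x that]] c by simp
    qed (use measurable_fiber[OF meas(2) x] in auto)
    have "(\<integral>s. exp (l * (g (x(k := s)) - E)) * \<rho> (x(k := s)) \<partial>M)
        = (\<integral>s. exp (l * (g' x - E)) * (exp (l * (g (x(k := s)) - g' x)) * \<rho> (x(k := s))) \<partial>M)"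
      by (simp only: mult.assoc[symmetric] mult_exp_exp distrib_left[symmetric]) simp
    also have "\<dots> \<le> exp (l * (g' x - E)) * (exp (l\<^sup>2 * \<delta>\<^sup>2 / 8) * \<rho>' x)"
      using H by (simp add: mult_left_mono)
    finally show ?thesis by (simp add: mult_ac)
  qed
  have prodint: "integrable (cube k) (\<lambda>x. \<integral>s. exp (l * (g (x(k := s)) - E)) * \<rho> (x(k := s)) \<partial>M)"
  proof (rule Bochner_Integration.integrable_bound)
    show "integrable (cube k) (\<lambda>x. exp (l\<^sup>2 * \<delta>\<^sup>2 / 8) * (exp (l * (g' x - E)) * \<rho>' x))"
      using int_exp' by simp
    show "(\<lambda>x. \<integral>s. exp (l * (g (x(k := s)) - E)) * \<rho> (x(k := s)) \<partial>M) \<in> borel_measurable (cube k)"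
      by (rule measurable_integral_fiber) measurable
    show "AE x in cube k. norm (\<integral>s. exp (l * (g (x(k := s)) - E)) * \<rho> (x(k := s)) \<partial>M)
        \<le> norm (exp (l\<^sup>2 * \<delta>\<^sup>2 / 8) * (exp (l * (g' x - E)) * \<rho>' x))"
    proof (rule AE_I2)
      fix x assume x: "x \<in> space (cube k)"
      have "0 \<le> (\<integral>s. exp (l * (g (x(k := s)) - E)) * \<rho> (x(k := s)) \<partial>M)"
        using bd[OF cube_Suc_upd[OF x]] c
        by (intro integral_nonneg_AE AE_I2) (force intro: mult_nonneg_nonneg)
      then show "norm (\<integral>s. exp (l * (g (x(k := s)) - E)) * \<rho> (x(k := s)) \<partial>M)
          \<le> norm (exp (l\<^sup>2 * \<delta>\<^sup>2 / 8) * (exp (l * (g' x - E)) * \<rho>' x))"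
        using fiber[OF x] by simp
    qed
  qed
  have "(\<integral>x. exp (l * (g x - E)) * \<rho> x \<partial>cube (Suc k))
      = (\<integral>x. (\<integral>s. exp (l * (g (x(k := s)) - E)) * \<rho> (x(k := s)) \<partial>M) \<partial>cube k)"
    by (rule integral_cube_Suc[OF int_exp])
  also have "\<dots> \<le> (\<integral>x. exp (l\<^sup>2 * \<delta>\<^sup>2 / 8) * (exp (l * (g' x - E)) * \<rho>' x) \<partial>cube k)"
    by (rule integral_mono) (use prodint int_exp' fiber in auto)
  also have "\<dots> = exp (l\<^sup>2 * \<delta>\<^sup>2 / 8) * (\<integral>x. exp (l * (g' x - E)) * \<rho>' x \<partial>cube k)"
    by simp
  also have "\<dots> \<le> exp (l\<^sup>2 * \<delta>\<^sup>2 / 8)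
      * (exp (l\<^sup>2 * (real k * (\<delta> * (1 + \<kappa> / 4) * (1 + q / 4) ^ k)\<^sup>2) / 8) * (\<integral>x. \<rho>' x \<partial>cube k))"
    unfolding E using Suc.IH[OF \<kappa>'q(2,1) \<rho>' g'] Suc.prems(1,5) by (intro mult_left_mono) auto
  also have "\<dots> = exp (l\<^sup>2 * (\<delta>\<^sup>2 + real k * (\<delta> * (1 + \<kappa> / 4) * (1 + q / 4) ^ k)\<^sup>2) / 8) * (\<integral>x. \<rho>' x \<partial>cube k)"
    by (simp only: mult.assoc[symmetric] mult_exp_exp distrib_left add_divide_distrib)
  \<comment> \<open>Each of the \<open>Suc k\<close> squared oscillations is bounded by the largest
    one, with \<kappa> replaced by its ceiling \<open>q\<close>.\<close>
  also have "\<dots> \<le> exp (l\<^sup>2 * (real (Suc k) * (\<delta> * (1 + q / 4) ^ Suc k)\<^sup>2) / 8) * (\<integral>x. \<rho>' x \<partial>cube k)"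
  proof (rule mult_right_mono)
    have "\<delta> * (1 + \<kappa> / 4) * (1 + q / 4) ^ k \<le> \<delta> * (1 + q / 4) * (1 + q / 4) ^ k"
      using \<kappa>q q Suc.prems(5) by (intro mult_right_mono mult_left_mono) auto
    then have 1: "(\<delta> * (1 + \<kappa> / 4) * (1 + q / 4) ^ k)\<^sup>2 \<le> (\<delta> * (1 + q / 4) ^ Suc k)\<^sup>2"
      using Suc.prems(1,5) q by (intro power_mono) (auto simp: mult_ac)
    have "\<delta> * 1 \<le> \<delta> * (1 + q / 4) ^ Suc k"
      using q Suc.prems(5) by (intro mult_left_mono one_le_power) auto
    then have "\<delta>\<^sup>2 \<le> (\<delta> * (1 + q / 4) ^ Suc k)\<^sup>2"
      using Suc.prems(5) by (intro power_mono) auto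
    then have "\<delta>\<^sup>2 + real k * (\<delta> * (1 + \<kappa> / 4) * (1 + q / 4) ^ k)\<^sup>2
        \<le> (\<delta> * (1 + q / 4) ^ Suc k)\<^sup>2 + real k * (\<delta> * (1 + q / 4) ^ Suc k)\<^sup>2"
      using 1 by (intro add_mono mult_left_mono) auto
    also have "\<dots> = real (Suc k) * (\<delta> * (1 + q / 4) ^ Suc k)\<^sup>2"
      by (simp only: of_nat_Suc distrib_right mult_1)
    finally have "l\<^sup>2 * (\<delta>\<^sup>2 + real k * (\<delta> * (1 + \<kappa> / 4) * (1 + q / 4) ^ k)\<^sup>2) / 8
        \<le> l\<^sup>2 * (real (Suc k) * (\<delta> * (1 + q / 4) ^ Suc k)\<^sup>2) / 8"
      by (intro divide_right_mono mult_left_mono) auto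
    then show "exp (l\<^sup>2 * (\<delta>\<^sup>2 + real k * (\<delta> * (1 + \<kappa> / 4) * (1 + q / 4) ^ k)\<^sup>2) / 8)
        \<le> exp (l\<^sup>2 * (real (Suc k) * (\<delta> * (1 + q / 4) ^ Suc k)\<^sup>2) / 8)"
      by simp
    show "0 \<le> (\<integral>x. \<rho>' x \<partial>cube k)"
      using marg c by (intro integral_nonneg_AE AE_I2) force
  qed
  finally show ?case
    unfolding E_def int\<rho>' .
qed

section \<open>From exponential moments to tail bounds\<close>

lemma osc_bounded_uminus: "osc_bounded \<delta> k g \<Longrightarrow> osc_bounded \<delta> k (\<lambda>x. - g x)"
  unfolding osc_bounded_def by (auto simp: abs_minus_commute)

text \<open>A fixed point \<open>x\<close> is turned into an arbitrary point \<open>y\<close> by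
  replacing one coordinate at a time; each of the \<open>k\<close> replacements changes
  \<open>g\<close> by at most \<delta>, whence boundedness.\<close>

lemma osc_bounded_of_coord_osc:
  assumes g: "g \<in> borel_measurable (cube k)"
    and osc: "\<And>x j u. x \<in> space (cube k) \<Longrightarrow> j < k \<Longrightarrow> u \<in> space M \<Longrightarrow> \<bar>g (x(j := u)) - g x\<bar> \<le> \<delta>"
  shows "osc_bounded \<delta> k g"
proof -
  obtain x where x: "x \<in> space (cube k)"
    using prob_space.not_empty[OF prob_space_cube] by blast
  have "\<bar>g y\<bar> \<le> \<bar>g x\<bar> + real k * \<delta>" if y: "y \<in> space (cube k)" for y
  proof -
    define z where "z m i = (if i < m then y i else x i)" for m i :: nat
    have z: "z m \<in> space (cube k)" for m
      using x y by (auto simp: z_def space_PiM PiE_def extensional_def)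
    have "\<bar>g (z m) - g x\<bar> \<le> real m * \<delta>" if "m \<le> k" for m
      using that
    proof (induction m)
      case 0
      then show ?case by (simp add: z_def[abs_def])
    next
      case (Suc m)
      have "z (Suc m) = (z m)(m := y m)" by (auto simp: z_def fun_eq_iff less_Suc_eq)
      then have "\<bar>g (z (Suc m)) - g (z m)\<bar> \<le> \<delta>"
        using osc[OF z, of m "y m"] Suc.prems cube_coord[OF y, of m] by simp
      then show ?case using Suc by (simp add: algebra_simps)
    qed
    moreover have "z k = y"
      using x y by (auto simp: z_def fun_eq_iff space_PiM PiE_def extensional_def)
    ultimately show ?thesis by fastforce
  qed
  then show ?thesis
    unfolding osc_bounded_def using g osc by blast
qed

text \<open>Chernoff's method with q = 1/N in the exponential moment bound. The share 7/10 of
  \<open>q\<close> goes to the initial excess \<kappa>, the share 3/10 to its growth over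
  \<open>N\<close> integrations.\<close>

lemma upper_tail_le:
  assumes N: "5 \<le> N" and \<kappa>: "0 \<le> \<kappa>" "\<kappa> \<le> 7 / (10 * real N)"
    and \<rho>: "cross_ratio_bounded (1 + \<kappa>) N \<rho>" and \<rho>1: "(\<integral>x. \<rho> x \<partial>cube N) = 1"
    and g: "osc_bounded (1 / real N) N g" and \<epsilon>: "0 < \<epsilon>"
  defines "\<mu> \<equiv> density (cube N) (\<lambda>x. ennreal (\<rho> x))"
  shows "measure \<mu> {x \<in> space \<mu>. \<epsilon> \<le> g x - (\<integral>x. g x \<partial>\<mu>)} \<le> exp (- (\<epsilon>\<^sup>2 * real N))"
proof -
  from \<rho> obtain c C where c: "0 < c" and
    bd: "\<And>x. x \<in> space (cube N) \<Longrightarrow> c \<le> \<rho> x \<and> \<rho> x \<le> C"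
    unfolding cross_ratio_bounded_def by blast
  from g obtain B where B: "\<And>x. x \<in> space (cube N) \<Longrightarrow> \<bar>g x\<bar> \<le> B"
    unfolding osc_bounded_def by blast
  have meas[measurable]: "\<rho> \<in> borel_measurable (cube N)" "g \<in> borel_measurable (cube N)"
    using \<rho> g unfolding cross_ratio_bounded_def osc_bounded_def by blast+
  have nn: "AE x in cube N. 0 \<le> \<rho> x" using bd c by (intro AE_I2) force
  \<comment> \<open>With exp (1/2) rounded up to 2, the exponent to minimise is l^2/(4N) - l
    \<epsilon>. Its minimum, at this \<open>l\<close>, is -\<epsilon>^2 N.\<close>
  define l where "l = 2 * real N * \<epsilon>"
  have l: "0 < l" using N \<epsilon> by (simp add: l_def)
  have int\<mu>: "(\<integral>x. h x \<partial>\<mu>) = (\<integral>x. h x * \<rho> x \<partial>cube N)"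
    if "h \<in> borel_measurable (cube N)" for h :: "(nat \<Rightarrow> 'a) \<Rightarrow> real"
    unfolding \<mu>_def using that nn by (subst integral_density) (auto simp: mult.commute)
  define E where "E = (\<integral>x. g x \<partial>\<mu>)"
  have E: "E = (\<integral>x. g x * \<rho> x \<partial>cube N)"
    unfolding E_def by (rule int\<mu>) measurable
  have int: "integrable \<mu> (\<lambda>x. exp (l * (g x - E)))"
    unfolding \<mu>_def
  proof (subst integrable_density)
    show "integrable (cube N) (\<lambda>x. \<rho> x *\<^sub>R exp (l * (g x - E)))"
    proof (rule integrable_cube[of _ _ "C * exp (l * (B - E))"])
      fix x assume x: "x \<in> space (cube N)"
      have "exp (l * (g x - E)) \<le> exp (l * (B - E))"
        using B[OF x] l by simp
      then show "\<bar>\<rho> x *\<^sub>R exp (l * (g x - E))\<bar> \<le> C * exp (l * (B - E))"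
        using bd[OF x] c by (auto simp: abs_mult intro!: mult_mono)
    qed measurable
  qed (use nn in auto)
  have q: "\<kappa> + 3 / 10 * real N * (1 / real N)\<^sup>2 \<le> 1 / real N"
  proof -
    have "3 / 10 * real N * (1 / real N)\<^sup>2 = 3 / (10 * real N)"
      using N by (simp add: power2_eq_square field_simps)
    moreover have "7 / (10 * real N) + 3 / (10 * real N) = 1 / real N"
      using N by (simp add: field_simps)
    ultimately show ?thesis using \<kappa>(2) by linarith
  qed
  have N5: "1 / real N \<le> 1 / 5" using N by (simp add: field_simps)
  have "(\<integral>x. exp (l * (g x - E)) \<partial>\<mu>) = (\<integral>x. exp (l * (g x - E)) * \<rho> x \<partial>cube N)"
    by (rule int\<mu>) measurable
  also have "\<dots> \<le> exp (l\<^sup>2 * (real N * (1 / real N * (1 + 1 / real N / 4) ^ N)\<^sup>2) / 8)"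
    using integral_exp_deviation_le[OF _ N5 l \<kappa>(1) q \<rho> g] by (simp add: \<rho>1 E)
  also have "\<dots> \<le> exp (\<epsilon>\<^sup>2 * real N)"
  proof -
    have "(1 + 1 / real N / 4) ^ N \<le> exp (1 / real N / 4) ^ N"
      by (intro power_mono exp_ge_add_one_self) auto
    also have "\<dots> = exp (1 / 4)" using N by (simp flip: exp_of_nat_mult)
    finally have "((1 + 1 / real N / 4) ^ N)\<^sup>2 \<le> (exp (1 / 4))\<^sup>2"
      by (intro power_mono) auto
    also have "\<dots> = exp (1 / 2 :: real)" by (simp flip: exp_double)
    also have "\<dots> \<le> 2" using exp_bound[of "1 / 2"] by (simp add: power2_eq_square)
    finally have 2: "((1 + 1 / real N / 4) ^ N)\<^sup>2 \<le> 2" .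
    have "l\<^sup>2 * (real N * (1 / real N * (1 + 1 / real N / 4) ^ N)\<^sup>2) / 8
        = \<epsilon>\<^sup>2 * real N / 2 * ((1 + 1 / real N / 4) ^ N)\<^sup>2"
      unfolding l_def power_mult_distrib using N by (simp add: power2_eq_square field_simps)
    also have "\<dots> \<le> \<epsilon>\<^sup>2 * real N / 2 * 2"
      using 2 by (intro mult_left_mono) auto
    finally show ?thesis by simp
  qed
  finally have mgf: "(\<integral>x. exp (l * (g x - E)) \<partial>\<mu>) \<le> exp (\<epsilon>\<^sup>2 * real N)" .
  have "{x \<in> space \<mu>. \<epsilon> \<le> g x - E} = {x \<in> space \<mu>. exp (l * \<epsilon>) \<le> exp (l * (g x - E))}"
    using l by simp
  then have "measure \<mu> {x \<in> space \<mu>. \<epsilon> \<le> g x - E} \<le> (\<integral>x. exp (l * (g x - E)) \<partial>\<mu>) / exp (l * \<epsilon>)"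
    using integral_Markov_inequality_measure[OF int, of "{}" "exp (l * \<epsilon>)"] by simp
  also have "\<dots> \<le> exp (\<epsilon>\<^sup>2 * real N) / exp (l * \<epsilon>)"
    using mgf by (intro divide_right_mono) auto
  also have "\<dots> = exp (- (\<epsilon>\<^sup>2 * real N))"
    by (simp add: l_def power2_eq_square flip: exp_diff)
  finally show ?thesis unfolding E_def .
qed

text \<open>The deviation event is covered by the upper tails of \<open>g\<close> and of
  \<open>-g\<close>, each of which contributes one exponential.\<close>

lemma two_sided_tail_le:
  assumes N: "5 \<le> N" and \<kappa>: "0 \<le> \<kappa>" "\<kappa> \<le> 7 / (10 * real N)"
    and \<rho>: "cross_ratio_bounded (1 + \<kappa>) N \<rho>" and g: "osc_bounded (1 / real N) N g" and \<epsilon>: "0 < \<epsilon>"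
  defines "\<mu> \<equiv> density (cube N) (\<lambda>x. ennreal (\<rho> x))"
  assumes \<mu>: "prob_space \<mu>"
  shows "measure \<mu> {x \<in> space \<mu>. \<epsilon> \<le> \<bar>g x - (\<integral>x. g x \<partial>\<mu>)\<bar>} \<le> 2 * exp (- (\<epsilon>\<^sup>2 * real N))"
proof -
  interpret P: prob_space \<mu> by fact
  from \<rho> obtain c C where c: "0 < c" and
    bd: "\<And>x. x \<in> space (cube N) \<Longrightarrow> c \<le> \<rho> x \<and> \<rho> x \<le> C"
    unfolding cross_ratio_bounded_def by blast
  have meas[measurable]: "\<rho> \<in> borel_measurable (cube N)" "g \<in> borel_measurable (cube N)"
    using \<rho> g unfolding cross_ratio_bounded_def osc_bounded_def by blast+
  have "ennreal (\<integral>x. \<rho> x \<partial>cube N) = (\<integral>\<^sup>+x. ennreal (\<rho> x) \<partial>cube N)"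
    by (intro nn_integral_eq_integral[symmetric] integrable_cube[of _ _ C] AE_I2) (use bd c in force)+
  also have "\<dots> = emeasure \<mu> (space \<mu>)"
    unfolding \<mu>_def by (simp add: emeasure_density cong: nn_integral_cong_simp)
  finally have \<rho>1: "(\<integral>x. \<rho> x \<partial>cube N) = 1"
    by (simp add: P.emeasure_space_1)
  let ?E = "\<integral>x. g x \<partial>\<mu>"
  have [measurable]: "g \<in> borel_measurable \<mu>" by (simp add: \<mu>_def)
  have "measure \<mu> {x \<in> space \<mu>. \<epsilon> \<le> \<bar>g x - ?E\<bar>}
      \<le> measure \<mu> ({x \<in> space \<mu>. \<epsilon> \<le> g x - ?E} \<union> {x \<in> space \<mu>. \<epsilon> \<le> - g x - (\<integral>x. - g x \<partial>\<mu>)})"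
    by (rule P.finite_measure_mono) (auto simp: abs_real_def split: if_splits)
  also have "\<dots> \<le> measure \<mu> {x \<in> space \<mu>. \<epsilon> \<le> g x - ?E}
      + measure \<mu> {x \<in> space \<mu>. \<epsilon> \<le> - g x - (\<integral>x. - g x \<partial>\<mu>)}"
    by (rule measure_Un_le) measurable
  also have "\<dots> \<le> exp (- (\<epsilon>\<^sup>2 * real N)) + exp (- (\<epsilon>\<^sup>2 * real N))"
    unfolding \<mu>_def
    by (intro add_mono upper_tail_le[OF N \<kappa> \<rho> \<rho>1 _ \<epsilon>] g osc_bounded_uminus)
  finally show ?thesis by simp
qed

end

section \<open>Cross ratios of densities in the class\<close>

lemma periodic_eq_frac:
  fixes f :: "real \<Rightarrow> 'b"
  assumes "\<And>x. f (x + 1) = f x"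
  shows "f x = f (frac x)"
proof -
  interpret periodic_fun_simple' f by unfold_locales (rule assms)
  show ?thesis by (simp add: frac_def minus_of_int)
qed

lemma deriv_periodic:
  fixes f :: "real \<Rightarrow> real"
  assumes "\<And>x. f (x + 1) = f x"
  shows "deriv f (x + 1) = deriv f x"
  unfolding deriv_def using DERIV_shift[of f _ x 1] assms by simp

text \<open>Besides regularity, this rewrites the bound on the logarithmic derivative as one between
  \<psi>' and a \<psi>, a form suited to linear combinations.\<close>

lemma Vcone_facts:
  assumes "Vcone a \<psi>"
  shows "\<psi> x > 0" "\<psi> (x + 1) = \<psi> x" "(\<psi> has_real_derivative deriv \<psi> x) (at x)"
    "(deriv \<psi> has_real_derivative deriv (deriv \<psi>) x) (at x)"
    "continuous_on UNIV (deriv (deriv \<psi>))" "\<bar>deriv \<psi> x\<bar> < a * \<psi> x"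
    "continuous_on S \<psi>" "continuous_on S (deriv \<psi>)"
proof -
  have d: "\<psi> differentiable (at x)" "deriv \<psi> differentiable (at x)" for x
    using assms by (auto simp: Vcone_def C2_real_def)
  then have D: "(\<psi> has_real_derivative deriv \<psi> x) (at x)"
    "(deriv \<psi> has_real_derivative deriv (deriv \<psi>) x) (at x)" for x
    by (meson DERIV_deriv_iff_real_differentiable)+
  then show "(\<psi> has_real_derivative deriv \<psi> x) (at x)"
    "(deriv \<psi> has_real_derivative deriv (deriv \<psi>) x) (at x)" by auto
  show pos: "\<psi> x > 0" and "\<psi> (x + 1) = \<psi> x" "continuous_on UNIV (deriv (deriv \<psi>))"
    using assms by (auto simp: Vcone_def C2_real_def)
  show "continuous_on S \<psi>" "continuous_on S (deriv \<psi>)"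
    using D by (meson DERIV_continuous_on has_field_derivative_at_within)+
  have "((\<lambda>t. ln (\<psi> t)) has_real_derivative deriv \<psi> x / \<psi> x) (at x)"
    using D[of x] pos by (auto intro!: derivative_eq_intros)
  then have "\<bar>deriv \<psi> x / \<psi> x\<bar> < a"
    using assms unfolding Vcone_def by (metis DERIV_imp_deriv)
  then show "\<bar>deriv \<psi> x\<bar> < a * \<psi> x" using pos by (simp add: abs_divide field_simps)
qed

text \<open>This makes the set defining \<open>beta_cone\<close> nonempty, so that its infimum is
  meaningful. The cone condition for t \<psi>1 - \<psi>2 follows once b \<psi>2 + |\<psi>2'| < t (b
  \<psi>1 - |\<psi>1'|) everywhere. By compactness of a period the left side is bounded and the
  bracket on the right is bounded away from 0, as a \<le> b.\<close>

lemma Vcone_scaled_diff: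
  assumes ab: "0 < a" "a \<le> b" and V: "Vcone a \<psi>1" "Vcone a \<psi>2"
  obtains t where "0 < t" "Vcone b (\<lambda>x. t * \<psi>1 x - \<psi>2 x)"
proof -
  note V1 = Vcone_facts[OF V(1)] and V2 = Vcone_facts[OF V(2)]
  define h where "h x = b * \<psi>1 x - \<bar>deriv \<psi>1 x\<bar>" for x
  define k where "k x = b * \<psi>2 x + \<bar>deriv \<psi>2 x\<bar>" for x
  have per: "h (x + 1) = h x" "k (x + 1) = k x" for x
    using V1(2) V2(2) by (simp_all add: h_def k_def deriv_periodic)
  have "continuous_on {0..1} h" "continuous_on {0..1} k"
    unfolding h_def k_def using V1 V2 by (auto intro!: continuous_intros)
  then obtain x1 x2 where x1: "\<And>x. x \<in> {0..1} \<Longrightarrow> h x1 \<le> h x" and x2: "\<And>x. x \<in> {0..1} \<Longrightarrow> k x \<le> k x2"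
    using continuous_attains_inf[of "{0..1::real}" h] continuous_attains_sup[of "{0..1::real}" k]
    by (auto simp: Ball_def)
  have hmin: "h x1 \<le> h x" and kmax: "k x \<le> k x2" for x
  proof -
    have "frac x \<in> {0..1}" by (simp add: less_imp_le frac_lt_1)
    then show "h x1 \<le> h x" "k x \<le> k x2"
      using x1 x2 periodic_eq_frac[of h x] periodic_eq_frac[of k x] per by auto
  qed
  have "a * \<psi>1 x1 \<le> b * \<psi>1 x1" using ab V1(1)[of x1] by (intro mult_right_mono) auto
  then have hpos: "0 < h x1" using V1(6)[of x1] by (simp add: h_def)
  have kpos: "0 < k x2" using ab V2(1)[of x2] by (simp add: k_def add_pos_nonneg)
  \<comment> \<open>Twice the ratio of the maximum of \<open>k\<close> to the minimum of
    \<open>h\<close>; the factor 2 makes \<open>key\<close> strict.\<close>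
  define t where "t = 2 * k x2 / h x1"
  have t: "0 < t" using hpos kpos by (simp add: t_def)
  have key: "k x < t * h x" for x
  proof -
    have "k x < 2 * k x2" using kmax[of x] kpos by linarith
    also have "\<dots> = t * h x1" using hpos by (simp add: t_def)
    also have "\<dots> \<le> t * h x" using t hmin by (intro mult_left_mono) auto
    finally show ?thesis .
  qed
  let ?\<psi> = "\<lambda>x. t * \<psi>1 x - \<psi>2 x"
  have D1: "(?\<psi> has_real_derivative t * deriv \<psi>1 x - deriv \<psi>2 x) (at x)" for x
    using V1(3) V2(3) by (auto intro!: derivative_eq_intros)
  then have d1: "deriv ?\<psi> = (\<lambda>x. t * deriv \<psi>1 x - deriv \<psi>2 x)"
    by (auto intro: DERIV_imp_deriv)
  have D2: "(deriv ?\<psi> has_real_derivative t * deriv (deriv \<psi>1) x - deriv (deriv \<psi>2) x) (at x)" for x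
    unfolding d1 using V1(4) V2(4) by (auto intro!: derivative_eq_intros)
  then have d2: "deriv (deriv ?\<psi>) = (\<lambda>x. t * deriv (deriv \<psi>1) x - deriv (deriv \<psi>2) x)"
    by (auto intro: DERIV_imp_deriv)
  have bound: "\<bar>t * deriv \<psi>1 x - deriv \<psi>2 x\<bar> < b * ?\<psi> x" for x
  proof -
    have "\<bar>t * deriv \<psi>1 x - deriv \<psi>2 x\<bar> \<le> t * \<bar>deriv \<psi>1 x\<bar> + \<bar>deriv \<psi>2 x\<bar>"
      using t abs_triangle_ineq4[of "t * deriv \<psi>1 x" "deriv \<psi>2 x"] by (simp add: abs_mult)
    also have "\<dots> < b * ?\<psi> x" using key[of x] by (simp add: h_def k_def algebra_simps)
    finally show ?thesis .
  qed
  \<comment> \<open>Positivity comes for free: b times the function strictly exceeds an absolute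
    value.\<close>
  have "0 < b * ?\<psi> x" for x using bound[of x] by linarith
  then have pos: "0 < ?\<psi> x" for x using ab by (simp add: zero_less_mult_iff)
  have "\<bar>deriv (\<lambda>x. ln (?\<psi> x)) x\<bar> < b" for x
  proof -
    have "((\<lambda>x. ln (?\<psi> x)) has_real_derivative (t * deriv \<psi>1 x - deriv \<psi>2 x) / ?\<psi> x) (at x)"
      using DERIV_chain2[OF DERIV_ln_divide[OF pos] D1] by simp
    then show ?thesis
      using bound[of x] pos[of x] by (simp add: DERIV_imp_deriv abs_divide field_simps)
  qed
  moreover have "C2_real ?\<psi>"
    unfolding C2_real_def
  proof (intro conjI allI)
    show "?\<psi> differentiable (at x)" "deriv ?\<psi> differentiable (at x)" for x
      using D1 D2 real_differentiable_def by blast+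
    show "continuous_on UNIV (deriv (deriv ?\<psi>))"
      unfolding d2 using V1(5) V2(5) by (auto intro!: continuous_intros)
  qed
  ultimately have "Vcone b ?\<psi>"
    unfolding Vcone_def using pos V1(2) V2(2) by auto
  with t that show ?thesis by blast
qed

text \<open>Positivity of t \<psi>1 - \<psi>2 at \<open>x\<close> pushes every admissible
  \<open>t\<close> above the ratio there, and the infimum over the nonempty admissible set inherits
  the bound.\<close>

lemma beta_cone_ge_ratio:
  assumes ab: "0 < a" "a \<le> b" and V: "Vcone a \<psi>1" "Vcone a \<psi>2"
  shows "\<psi>2 x / \<psi>1 x \<le> beta_cone b \<psi>1 \<psi>2"
  unfolding beta_cone_def
proof (rule cInf_greatest)
  show "{t. 0 < t \<and> Vcone b (\<lambda>x. t * \<psi>1 x - \<psi>2 x)} \<noteq> {}"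
    using Vcone_scaled_diff[OF ab V] by blast
next
  fix t assume "t \<in> {t. 0 < t \<and> Vcone b (\<lambda>x. t * \<psi>1 x - \<psi>2 x)}"
  then have "0 < t * \<psi>1 x - \<psi>2 x" using Vcone_facts(1) by blast
  then show "\<psi>2 x / \<psi>1 x \<le> t"
    using Vcone_facts(1)[OF V(1), of x] by (simp add: field_simps)
qed

text \<open>Multiply the bounds on the two betas, taken at \<open>x\<close> and at \<open>y\<close>.
  Both betas exceed positive ratios, so the exponential undoes the logarithms in
  \<open>theta_cone\<close>.\<close>

lemma theta_cone_cross_ratio:
  assumes ab: "0 < a" "a \<le> b" and V: "Vcone a \<psi>1" "Vcone a \<psi>2"
  shows "\<psi>2 x * \<psi>1 y \<le> exp (theta_cone b \<psi>1 \<psi>2) * (\<psi>1 x * \<psi>2 y)"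
proof -
  have pos: "0 < \<psi>1 x" "0 < \<psi>2 x" "0 < \<psi>1 y" "0 < \<psi>2 y"
    using Vcone_facts(1) V by blast+
  have b1: "\<psi>2 x / \<psi>1 x \<le> beta_cone b \<psi>1 \<psi>2" and b2: "\<psi>1 y / \<psi>2 y \<le> beta_cone b \<psi>2 \<psi>1"
    using beta_cone_ge_ratio[OF ab V] beta_cone_ge_ratio[OF ab V(2,1)] by auto
  have bp: "0 < beta_cone b \<psi>1 \<psi>2" "0 < beta_cone b \<psi>2 \<psi>1"
    using b1 b2 pos by (meson divide_pos_pos less_le_trans)+
  have "\<psi>2 x / \<psi>1 x * (\<psi>1 y / \<psi>2 y) \<le> beta_cone b \<psi>1 \<psi>2 * beta_cone b \<psi>2 \<psi>1"
    using b1 b2 bp pos by (intro mult_mono) auto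
  also have "\<dots> = exp (theta_cone b \<psi>1 \<psi>2)"
    using bp by (simp add: theta_cone_def exp_add)
  finally show ?thesis using pos by (simp add: field_simps)
qed

text \<open>The conditional densities before and after changing coordinate \<open>j\<close> are
  compared at \<open>u\<close> and \<open>x i\<close>. Their normalising integrals occur once on
  each side and cancel, and the torus distance is at most 1/2.\<close>

lemma class_M_cross_ratio:
  assumes ab: "0 < a" "a \<le> b" and \<rho>: "class_M a b L N \<rho>" and L: "0 \<le> L"
    and ij: "i < N" "j < N" "i \<noteq> j"
  shows "\<rho> x * \<rho> (x(i := u, j := v)) \<le> exp (L / 2) * (\<rho> (x(i := u)) * \<rho> (x(j := v)))"
proof -
  let ?p = "cond_density \<rho> i x" and ?q = "cond_density \<rho> i (x(j := v))"
  let ?Z = "integral {0..1} (\<lambda>t. \<rho> (x(i := t)))" and ?W = "integral {0..1} (\<lambda>t. \<rho> (x(j := v, i := t)))"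
  have pos: "0 < \<rho> y" for y using \<rho> by (auto simp: class_M_def torus_density_def)
  have V: "Vcone a ?p" "Vcone a ?q" and "theta_cone b ?p ?q \<le> L * tdist (x j) v"
    using \<rho> ij by (auto simp: class_M_def)
  moreover have "tdist (x j) v \<le> 1 / 2"
    using of_int_round_abs_le[of "x j - v"] by (simp add: tdist_def abs_minus_commute)
  then have "L * tdist (x j) v \<le> L * (1 / 2)" using L by (rule mult_left_mono)
  ultimately have \<theta>: "theta_cone b ?p ?q \<le> L / 2" by simp
  have pq: "0 < ?p s" "0 < ?q s" for s using V by (auto intro: Vcone_facts)
  \<comment> \<open>The signs are read off from the quotients: the conditional densities and \<rho>
    are both positive.\<close>
  have Z: "0 < ?Z" "0 < ?W"
    using pq(1)[of "x i"] pq(2)[of "x i"] pos[of x] pos[of "x(j := v, i := x i)"]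
    by (auto simp: cond_density_def zero_less_divide_iff)
  have "?q u * ?p (x i) \<le> exp (theta_cone b ?p ?q) * (?p u * ?q (x i))"
    by (rule theta_cone_cross_ratio[OF ab V])
  also have "\<dots> \<le> exp (L / 2) * (?p u * ?q (x i))"
    using \<theta> pq by (intro mult_right_mono) (auto intro!: mult_nonneg_nonneg less_imp_le)
  finally have "\<rho> (x(j := v, i := u)) / ?W * (\<rho> x / ?Z)
      \<le> exp (L / 2) * (\<rho> (x(i := u)) / ?Z * (\<rho> (x(j := v)) / ?W))"
    using ij by (simp add: cond_density_def fun_upd_twist[of j i] del: times_divide_eq_right times_divide_eq_left)
  then show ?thesis
    using Z ij by (simp add: field_simps fun_upd_twist[of j i])
qed

section \<open>The torus as a product probability space\<close>

abbreviation unit_leb :: "real measure" where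
  "unit_leb \<equiv> restrict_space lborel {0..<1}"

lemma space_unit_leb: "space unit_leb = {0..<1}"
  by (simp add: space_restrict_space)

lemma prob_space_unit_leb: "prob_space unit_leb"
  by (rule prob_spaceI) (simp add: space_restrict_space emeasure_restrict_space)

text \<open>Continuity refers to the product topology on all functions from nat to real, while
  points of the torus are \<open>undefined\<close> from index \<open>N\<close> on. The inclusion is
  measurable coordinatewise, being constant in those extra coordinates.\<close>

lemma borel_measurable_torus_leb:
  fixes f :: "(nat \<Rightarrow> real) \<Rightarrow> real"
  assumes "continuous_on UNIV f"
  shows "f \<in> borel_measurable (torus_leb N)"
proof -
  have "(\<lambda>x. x) \<in> measurable (torus_leb N) (PiM UNIV (\<lambda>_. borel :: real measure))"
    unfolding torus_leb_def
  proof (rule measurable_PiM_single')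
    fix i :: nat
    show "(\<lambda>x. x i) \<in> borel_measurable (PiM {..<N} (\<lambda>_. unit_leb))"
    proof (cases "i < N")
      case True
      then have "(\<lambda>x. x i) \<in> measurable (PiM {..<N} (\<lambda>_. unit_leb)) unit_leb" by simp
      moreover have "(\<lambda>x. x) \<in> borel_measurable unit_leb"
        by (rule measurable_restrict_space1) simp
      ultimately show ?thesis by (rule measurable_compose)
    next
      case False
      then have "x i = undefined" if "x \<in> space (PiM {..<N} (\<lambda>_. unit_leb))" for x
        using that by (auto simp: space_PiM PiE_def extensional_def)
      then show ?thesis by (subst measurable_cong[where g = "\<lambda>_. undefined"]) auto
    qed
  qed auto
  then have "(\<lambda>x. x) \<in> measurable (torus_leb N) (borel :: (nat \<Rightarrow> real) measure)"
    by (simp cong: measurable_cong_sets add: sets_PiM_equal_borel)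
  then show ?thesis
    using borel_measurable_continuous_onI[OF assms] by (rule measurable_compose)
qed

text \<open>The half-open cube is enclosed in a product of closed intervals and of singletons
  {undefined}, which is compact by Tychonoff's theorem; there \<rho>, being continuous, attains its
  extrema.\<close>

lemma bounded_on_torus_leb:
  fixes f :: "(nat \<Rightarrow> real) \<Rightarrow> real"
  assumes "continuous_on UNIV f" and pos: "\<And>x. 0 < f x"
  shows "\<exists>c>0. \<exists>C. \<forall>x\<in>space (torus_leb N). c \<le> f x \<and> f x \<le> C"
proof -
  define S where "S = PiE UNIV (\<lambda>i. if i < N then {0..1} else {undefined :: real})"
  have "compactin (product_topology (\<lambda>_. euclidean) UNIV) S"
    unfolding S_def compactin_PiE by auto
  then have S: "compact S" by (simp add: euclidean_product_topology)
  have "(\<lambda>i. if i < N then 0 else undefined) \<in> S" by (auto simp: S_def)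
  then have S0: "S \<noteq> {}" by blast
  have f: "continuous_on S f" using assms(1) continuous_on_subset by blast
  have sub: "space (torus_leb N) \<subseteq> S"
    by (auto simp: torus_leb_def space_PiM space_restrict_space S_def PiE_def extensional_def Pi_iff less_imp_le)
  obtain x1 x2 where "\<And>x. x \<in> S \<Longrightarrow> f x1 \<le> f x" "\<And>x. x \<in> S \<Longrightarrow> f x \<le> f x2"
    using continuous_attains_inf[OF S S0 f] continuous_attains_sup[OF S S0 f] by blast
  then show ?thesis using pos[of x1] sub by blast
qed

theorem theorem3:
  fixes a b :: real
  assumes "0 < a" and "a \<le> b"
  shows "\<exists>A>0. \<exists>N0::nat. \<forall>N\<ge>N0. \<forall>\<rho> g. \<forall>\<epsilon>>0.
     class_M a b (1 / real N) N \<rho> \<and>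
     prob_space (density (torus_leb N) (\<lambda>x. ennreal (\<rho> x))) \<and>
     osc_class (1 / real N) N g \<longrightarrow>
     (let \<mu> = density (torus_leb N) (\<lambda>x. ennreal (\<rho> x)) in
       measure \<mu> {x \<in> space \<mu>. \<bar>g x - integral\<^sup>L \<mu> g\<bar> \<ge> \<epsilon>}
         \<le> 2 * exp (- (\<epsilon>\<^sup>2 * real N) / (1 + A / real N)\<^sup>2))"
proof (rule exI[of _ 1], rule conjI, simp, rule exI[of _ 5], intro allI impI, elim conjE)
  \<comment> \<open>The choice is A = 1 and N0 = 5; the latter ensures q = 1/N \<le> 1/5 in the
    exponential moment bound.\<close>
  fix N :: nat and \<rho> g :: "(nat \<Rightarrow> real) \<Rightarrow> real" and \<epsilon> :: real
  assume N: "5 \<le> N" and \<epsilon>: "0 < \<epsilon>" and \<rho>: "class_M a b (1 / real N) N \<rho>"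
    and \<mu>: "prob_space (density (torus_leb N) (\<lambda>x. ennreal (\<rho> x)))" and g: "osc_class (1 / real N) N g"
  interpret U: prob_space unit_leb by (rule prob_space_unit_leb)
  have cube: "torus_leb N = U.cube N" by (simp add: torus_leb_def)
  define \<kappa> where "\<kappa> = exp (1 / real N / 2) - 1"
  \<comment> \<open>For N at least 5 the quadratic term is at most 1/(20 N), so \<kappa> \<le>
    11/(20 N), which is below 7/(10 N).\<close>
  have "exp (1 / real N / 2) \<le> 1 + 1 / real N / 2 + (1 / real N / 2)\<^sup>2"
    using N by (intro exp_bound) (auto simp: field_simps)
  also have "(1 / real N / 2)\<^sup>2 = 1 / real N / 4 * (1 / real N)"
    by (simp add: power2_eq_square)
  also have "\<dots> \<le> 1 / real N / 4 * (1 / 5)"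
    using N by (intro mult_left_mono) (auto simp: field_simps)
  finally have "\<kappa> \<le> 1 / real N / 2 + 1 / real N / 4 * (1 / 5)"
    by (simp add: \<kappa>_def)
  also have "\<dots> \<le> 7 / (10 * real N)"
    using N by (simp add: field_simps)
  finally have \<kappa>: "0 \<le> \<kappa>" "\<kappa> \<le> 7 / (10 * real N)"
    by (auto simp: \<kappa>_def)
  have cont: "continuous_on UNIV \<rho>" and pos: "\<And>x. 0 < \<rho> x"
    using \<rho> by (auto simp: class_M_def torus_density_def C2_multi_def)
  have "U.cross_ratio_bounded (1 + \<kappa>) N \<rho>"
    unfolding U.cross_ratio_bounded_def cube[symmetric]
    using borel_measurable_torus_leb[OF cont] bounded_on_torus_leb[OF cont pos]
      class_M_cross_ratio[OF assms \<rho>] by (simp add: \<kappa>_def)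
  moreover have "U.osc_bounded (1 / real N) N g"
    by (rule U.osc_bounded_of_coord_osc)
      (use g in \<open>auto simp: osc_class_def cube[symmetric] space_unit_leb\<close>)
  ultimately have "measure (density (torus_leb N) (\<lambda>x. ennreal (\<rho> x)))
      {x \<in> space (density (torus_leb N) (\<lambda>x. ennreal (\<rho> x))).
        \<epsilon> \<le> \<bar>g x - (\<integral>x. g x \<partial>density (torus_leb N) (\<lambda>x. ennreal (\<rho> x)))\<bar>}
      \<le> 2 * exp (- (\<epsilon>\<^sup>2 * real N))"
    using U.two_sided_tail_le[OF N \<kappa> _ _ \<epsilon>] \<mu> unfolding cube by blast
  also have "\<dots> \<le> 2 * exp (- (\<epsilon>\<^sup>2 * real N) / (1 + 1 / real N)\<^sup>2)"
  proof -
    \<comment> \<open>The bound obtained has exponent -\<epsilon>^2 N; dividing by a number at least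
      1 only enlarges the right-hand side.\<close>
    have "1 \<le> (1 + 1 / real N)\<^sup>2" by (intro one_le_power) simp
    then have "\<epsilon>\<^sup>2 * real N / (1 + 1 / real N)\<^sup>2 \<le> \<epsilon>\<^sup>2 * real N / 1"
      by (intro divide_left_mono) (auto simp: add_nonneg_eq_0_iff)
    then show ?thesis by simp
  qed
  finally show "let \<mu> = density (torus_leb N) (\<lambda>x. ennreal (\<rho> x)) in
      measure \<mu> {x \<in> space \<mu>. \<bar>g x - integral\<^sup>L \<mu> g\<bar> \<ge> \<epsilon>}
        \<le> 2 * exp (- (\<epsilon>\<^sup>2 * real N) / (1 + 1 / real N)\<^sup>2)"
    by (simp add: Let_def)
qed

end
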